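(* The universality problem for SAFA — given a SAFA $M$ over $\Sigma\times D$, decide whether $L(M)=(\Sigma\times D)^*$ — is undecidable.
   Context: Fix a countably infinite set $D$ of data values. For a finite alphabet $\Sigma$, a data word is a finite sequence in $(\Sigma\times D)^*$. A set augmented finite automaton (SAFA) is a tuple $M=(Q,\Sigma\times D,q_0,F,H,\delta)$ where $Q$ is a finite set of states, $q_0\in Q$ is initial, $F\subseteq Q$ final, $H=\{h_1,\dots,h_m\}$ a finite collection of (names of) sets of data values, and $\delta\subseteq Q\times\Sigma\times C\times OP\times Q$ with $C=\{p(h_i),\,!p(h_i): h_i\in H\}$ and $OP=\{-\}\cup\{\mathsf{ins}(h_i): h_i\in H\}$. A configuration is $(q,\langle S_1,\dots,S_m\rangle)$ with $S_i\subseteq D$ finite; initially the state is $q_0$ and all sets are empty. On reading $(a,d)$, a transition $(q,a,\alpha,op,q')\in\delta$ from the current state $q$ may be taken if $\alpha=p(h_i)$ and $d\in S_i$, or $\alpha=\,!p(h_i)$ and $d\notin S_i$; the state becomes $q'$ and if $op=\mathsf{ins}(h_j)$ then $d$ is added to $S_j$ (otherwise nothing changes). $M$ accepts a data word if some run reads it entirely and ends in $F$; $L(M)$ is the set of accepted words. The automaton is in general nondeterministic. *)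

theory Defs
  imports Main "HOL-Library.Nat_Bijection"
begin

datatype recf =
    Zero
  | Succ
  | Proj nat
  | Comp recf "recf list"
  | Prim recf recf
  | Mn recf

inductive eval :: "recf \<Rightarrow> nat list \<Rightarrow> nat \<Rightarrow> bool" where
  eval_Zero: "eval Zero xs 0"
| eval_Succ: "eval Succ (x # xs) (Suc x)"
| eval_Proj: "i < length xs \<Longrightarrow> eval (Proj i) xs (xs ! i)"
| eval_Comp: "list_all2 (\<lambda>g y. eval g xs y) gs ys \<Longrightarrow> eval f ys z \<Longrightarrow> eval (Comp f gs) xs z"
| eval_Prim0: "eval g xs z \<Longrightarrow> eval (Prim g h) (0 # xs) z"
| eval_PrimS: "eval (Prim g h) (n # xs) y \<Longrightarrow> eval h (n # y # xs) z
                 \<Longrightarrow> eval (Prim g h) (Suc n # xs) z"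
| eval_Mn: "eval f (n # xs) 0 \<Longrightarrow> (\<forall>i<n. \<exists>y. eval f (i # xs) y \<and> 0 < y)
              \<Longrightarrow> eval (Mn f) xs n"

definition decidable_on :: "nat set \<Rightarrow> (nat \<Rightarrow> bool) \<Rightarrow> bool" where
  "decidable_on Dom P \<longleftrightarrow> (\<exists>f. \<forall>n\<in>Dom. eval f [n] (if P n then 1 else 0))"

text \<open>States are 0..<n_states, alphabet letters are 0..<n_syms, set names h_i are
  0..<n_sets; the data domain D is the countably infinite type nat.
  A condition (True, i) is p(h_i), (False, i) is !p(h_i);
  an operation None is '-', Some j is ins(h_j).\<close>

type_synonym cond = "bool \<times> nat"
type_synonym trans = "nat \<times> nat \<times> cond \<times> nat option \<times> nat"

record safa =
  n_states :: nat
  n_syms :: nat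
  n_sets :: nat
  init :: nat
  finals :: "nat list"
  delta :: "trans list"

definition wf_safa :: "safa \<Rightarrow> bool" where
  "wf_safa M \<longleftrightarrow> init M < n_states M \<and> (\<forall>q\<in>set (finals M). q < n_states M) \<and>
     (\<forall>(q, a, (b, i), op, q')\<in>set (delta M).
        q < n_states M \<and> a < n_syms M \<and> i < n_sets M \<and> q' < n_states M \<and>
        (\<forall>j. op = Some j \<longrightarrow> j < n_sets M))"

type_synonym config = "nat \<times> (nat \<Rightarrow> nat set)"

definition holds :: "cond \<Rightarrow> (nat \<Rightarrow> nat set) \<Rightarrow> nat \<Rightarrow> bool" where
  "holds c S d = (if fst c then d \<in> S (snd c) else d \<notin> S (snd c))"

definition apply_op :: "nat option \<Rightarrow> (nat \<Rightarrow> nat set) \<Rightarrow> nat \<Rightarrow> (nat \<Rightarrow> nat set)" where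
  "apply_op op S d = (case op of None \<Rightarrow> S | Some j \<Rightarrow> S(j := insert d (S j)))"

definition step :: "safa \<Rightarrow> nat \<times> nat \<Rightarrow> config \<Rightarrow> config \<Rightarrow> bool" where
  "step M x c c' \<longleftrightarrow> (\<exists>\<alpha> op. (fst c, fst x, \<alpha>, op, fst c') \<in> set (delta M) \<and>
      holds \<alpha> (snd c) (snd x) \<and> snd c' = apply_op op (snd c) (snd x))"

fun reach :: "safa \<Rightarrow> (nat \<times> nat) list \<Rightarrow> config \<Rightarrow> config set" where
  "reach M [] c = {c}"
| "reach M (x # w) c = (\<Union>c'\<in>{c'. step M x c c'}. reach M w c')"

definition accepts :: "safa \<Rightarrow> (nat \<times> nat) list \<Rightarrow> bool" where
  "accepts M w \<longleftrightarrow> (\<exists>c\<in>reach M w (init M, \<lambda>_. {}). fst c \<in> set (finals M))"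

definition lang :: "safa \<Rightarrow> (nat \<times> nat) list set" where
  "lang M = {w. accepts M w}"

definition universal :: "safa \<Rightarrow> bool" where
  "universal M \<longleftrightarrow> lang M = lists ({0..<n_syms M} \<times> (UNIV :: nat set))"

definition encode_trans :: "trans \<Rightarrow> nat" where
  "encode_trans t = (case t of (q, a, (b, i), op, q') \<Rightarrow>
     list_encode [q, a, if b then 1 else 0, i, case op of None \<Rightarrow> 0 | Some j \<Rightarrow> Suc j, q'])"

definition encode_safa :: "safa \<Rightarrow> nat" where
  "encode_safa M = list_encode [n_states M, n_syms M, n_sets M, init M,
     list_encode (finals M), list_encode (map encode_trans (delta M))]"

end

theory Submission
  imports Defs
begin

text \<open>A run of a counter machine is a data word: an increment of a register carries a datum new to
  that register, a decrement carries a datum that was inserted and not yet removed, and a zero test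
  requires that every inserted datum has been removed. Each violation is witnessed by a single
  datum, so a nondeterministic SAFA can accept exactly the words that do not describe a
  halting run; it is universal iff the machine does not halt.

  Counter machines compute all recursive functions. If \<open>f\<close> decided universality, there would be a
  machine that, started with the code \<open>p\<close> of its own transitions, computes the code of the SAFA
  describing this very run, applies \<open>f\<close> to it, and halts iff \<open>f\<close> answers that the SAFA is
  universal, that is, iff the machine does not halt.\<close>

section \<open>Counter programs\<close>

text \<open>The automaton has to describe a run that starts by loading its input, so its own code
  cannot be that input. Only the transitions \<open>D\<close> of the program are fixed beforehand,
  and \<open>p\<close> is the code of \<open>D\<close>. The loading part, the number of states and
  the number of sets are explicit functions of \<open>p\<close>, so the code of the whole automaton
  is a primitive recursive function of \<open>p\<close>; this plays the part of the recursion
  theorem. A decider is only trusted on codes of well-formed automata, so well-formedness of this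
  particular automaton is part of the argument. Two features of SAFA shape the simulation. Sets
  never shrink, so a register takes two of them, one for insertions and one for removals. And a
  letter is compared with sets only through its own datum, so a zero test cannot inspect a register;
  the offending datum must be guessed when it is inserted and carried in a set of its own.\<close>

text \<open>A loop \<open>While r c\<close> decrements \<open>r\<close> before each execution of its body, so that it matches
  the combined zero test and decrement of a counter machine.\<close>

datatype com = Inc nat | Seq com com | While nat com

inductive bigstep :: "com \<Rightarrow> (nat \<Rightarrow> nat) \<Rightarrow> (nat \<Rightarrow> nat) \<Rightarrow> bool" where
  Inc: "bigstep (Inc r) s (s(r := Suc (s r)))"
| Seq: "bigstep c s t \<Longrightarrow> bigstep d t u \<Longrightarrow> bigstep (Seq c d) s u"
| While0: "s r = 0 \<Longrightarrow> bigstep (While r c) s s"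
| WhileS: "s r = Suc n \<Longrightarrow> bigstep c (s(r := n)) t \<Longrightarrow> bigstep (While r c) t u
             \<Longrightarrow> bigstep (While r c) s u"

lemma bigstep_Inc: "t = s(r := Suc (s r)) \<Longrightarrow> bigstep (Inc r) s t"
  by (simp add: bigstep.Inc)

lemma bigstep_While0: "s r = 0 \<Longrightarrow> t = s \<Longrightarrow> bigstep (While r c) s t"
  by (simp add: bigstep.While0)

text \<open>A no-op provided that \<open>b\<close> is zero; on any other value of \<open>b\<close>
  the loop would run forever.\<close>

definition skip :: "nat \<Rightarrow> com" where
  "skip b = While b (Inc b)"

lemma bigstep_skip: "s b = 0 \<Longrightarrow> bigstep (skip b) s s"
  unfolding skip_def by (rule While0)

definition clear :: "nat \<Rightarrow> nat \<Rightarrow> com" where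
  "clear b r = While r (skip b)"

lemma bigstep_clear: "b \<noteq> r \<Longrightarrow> s b = 0 \<Longrightarrow> bigstep (clear b r) s (s(r := 0))"
proof (induction "s r" arbitrary: s)
  case 0
  then show ?case unfolding clear_def by (intro bigstep_While0) auto
next
  case (Suc n)
  have "bigstep (clear b r) (s(r := n)) ((s(r := n))(r := 0))"
    using Suc by (intro Suc.hyps) auto
  moreover have "bigstep (skip b) (s(r := n)) (s(r := n))"
    using Suc by (intro bigstep_skip) auto
  ultimately show ?case using Suc.hyps(2)[symmetric] by (auto simp: clear_def intro: WhileS)
qed

fun clears :: "nat \<Rightarrow> nat list \<Rightarrow> com" where
  "clears b [] = skip b"
| "clears b (r # rs) = Seq (clear b r) (clears b rs)"

lemma bigstep_clears:
  "b \<notin> set rs \<Longrightarrow> s b = 0 \<Longrightarrow> bigstep (clears b rs) s (\<lambda>r. if r \<in> set rs then 0 else s r)"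
proof (induction rs arbitrary: s)
  case Nil
  then show ?case by (simp add: bigstep_skip)
next
  case (Cons r rs)
  have "bigstep (clears b rs) (s(r := 0)) (\<lambda>q. if q \<in> set rs then 0 else (s(r := 0)) q)"
    using Cons by auto
  also have "(\<lambda>q. if q \<in> set rs then 0 else (s(r := 0)) q) = (\<lambda>q. if q \<in> set (r # rs) then 0 else s q)"
    by auto
  finally have "bigstep (clears b rs) (s(r := 0)) (\<lambda>q. if q \<in> set (r # rs) then 0 else s q)" .
  moreover have "bigstep (clear b r) s (s(r := 0))"
    using Cons.prems by (intro bigstep_clear) auto
  ultimately show ?case unfolding clears.simps by (rule Seq[rotated])
qed

definition move :: "nat \<Rightarrow> nat \<Rightarrow> com" where
  "move a r = While a (Inc r)"

lemma bigstep_move: "a \<noteq> r \<Longrightarrow> bigstep (move a r) s (s(a := 0, r := s r + s a))"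
proof (induction "s a" arbitrary: s)
  case 0
  then show ?case unfolding move_def by (intro bigstep_While0) auto
next
  case (Suc n)
  let ?s = "s(a := n, r := Suc (s r))"
  have "bigstep (move a r) ?s (?s(a := 0, r := ?s r + ?s a))"
    using Suc by (intro Suc.hyps) auto
  also have "?s(a := 0, r := ?s r + ?s a) = s(a := 0, r := s r + s a)"
    using Suc by (auto simp: fun_eq_iff)
  finally have "bigstep (move a r) ?s (s(a := 0, r := s r + s a))" .
  moreover have "bigstep (Inc r) (s(a := n)) ?s"
    using Suc.prems by (intro bigstep_Inc) auto
  ultimately show ?case using Suc.hyps(2)[symmetric] by (auto simp: move_def intro: WhileS)
qed

text \<open>A loop consumes its counter, so the value of \<open>a\<close> is added to both
  \<open>r\<close> and the spare register \<open>b\<close>, from which \<open>a\<close> is then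
  restored.\<close>

definition copy :: "nat \<Rightarrow> nat \<Rightarrow> nat \<Rightarrow> com" where
  "copy b a r = Seq (While a (Seq (Inc b) (Inc r))) (move b a)"

lemma bigstep_copy:
  assumes "a \<noteq> r" "b \<noteq> r" "a \<noteq> b" "s b = 0"
  shows "bigstep (copy b a r) s (s(r := s r + s a))"
proof -
  have *: "bigstep (While a (Seq (Inc b) (Inc r))) s (s(a := 0, b := s b + s a, r := s r + s a))"
    if "a \<noteq> r" "b \<noteq> r" "a \<noteq> b" for s
    using that
  proof (induction "s a" arbitrary: s)
    case 0
    then show ?case by (intro bigstep_While0) auto
  next
    case (Suc n)
    let ?s = "s(a := n, b := Suc (s b), r := Suc (s r))"
    have "bigstep (While a (Seq (Inc b) (Inc r))) ?s (?s(a := 0, b := ?s b + ?s a, r := ?s r + ?s a))"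
      using Suc by (intro Suc.hyps) auto
    also have "?s(a := 0, b := ?s b + ?s a, r := ?s r + ?s a) = s(a := 0, b := s b + s a, r := s r + s a)"
      using Suc by (auto simp: fun_eq_iff)
    finally have "bigstep (While a (Seq (Inc b) (Inc r))) ?s (s(a := 0, b := s b + s a, r := s r + s a))" .
    moreover have "bigstep (Seq (Inc b) (Inc r)) (s(a := n)) ?s"
      using Suc.prems by (intro Seq[of _ _ "s(a := n, b := Suc (s b))"] bigstep_Inc) auto
    ultimately show ?case using Suc.hyps(2)[symmetric] by (auto intro: WhileS)
  qed
  let ?t = "s(a := 0, b := s b + s a, r := s r + s a)"
  have "bigstep (move b a) ?t (?t(b := 0, a := ?t a + ?t b))"
    using assms by (intro bigstep_move) auto
  also have "?t(b := 0, a := ?t a + ?t b) = s(r := s r + s a)"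
    using assms by (auto simp: fun_eq_iff)
  finally show ?thesis
    unfolding copy_def using *[of s] assms by (blast intro: Seq)
qed

section \<open>Counter programs compute all recursive functions\<close>

text \<open>Registers from \<open>b\<close> on are scratch space: they are zero before and after the execution.\<close>

definition implements :: "com \<Rightarrow> recf \<Rightarrow> nat list \<Rightarrow> nat \<Rightarrow> nat \<Rightarrow> bool" where
  "implements c f args res b \<longleftrightarrow>
     (\<forall>s y. eval f (map s args) y \<longrightarrow> s res = 0 \<longrightarrow> (\<forall>r\<ge>b. s r = 0) \<longrightarrow> bigstep c s (s(res := y)))"

inductive_cases eval_ZeroE: "eval Zero xs y"
inductive_cases eval_SuccE: "eval Succ xs y"
inductive_cases eval_ProjE: "eval (Proj i) xs y"
inductive_cases eval_CompE: "eval (Comp f gs) xs y"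
inductive_cases eval_Prim0E: "eval (Prim g h) (0 # xs) y"
inductive_cases eval_PrimSE: "eval (Prim g h) (Suc n # xs) y"
inductive_cases eval_PrimE: "eval (Prim g h) xs y"
inductive_cases eval_MnE: "eval (Mn f) xs y"

text \<open>\<open>F i\<close> is the accumulator before round \<open>i\<close> of the loop that
  will implement \<open>Prim\<close>; the loop invariant refers to it.\<close>

lemma eval_Prim_sequence:
  "eval (Prim g h) (n # xs) z \<Longrightarrow>
     \<exists>F. eval g xs (F 0) \<and> (\<forall>i<n. eval h (i # F i # xs) (F (Suc i))) \<and> F n = z"
proof (induction n arbitrary: z)
  case 0
  then show ?case by (auto elim: eval_Prim0E)
next
  case (Suc n)
  from Suc.prems obtain y where y: "eval (Prim g h) (n # xs) y" "eval h (n # y # xs) z"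
    by (auto elim: eval_PrimSE)
  from Suc.IH[OF y(1)] obtain F where F: "eval g xs (F 0)"
    "\<forall>i<n. eval h (i # F i # xs) (F (Suc i))" "F n = y" by blast
  show ?case
    using F y(2) by (intro exI[of _ "F(Suc n := z)"]) (auto simp: less_Suc_eq)
qed

text \<open>The programs run one after the other. Since \<open>rs\<close> avoids
  \<open>args\<close>, each still sees the original arguments; since the scratch space starts above
  \<open>rs\<close>, all can share it.\<close>

lemma implements_list:
  assumes "list_all2 (\<lambda>c (g, r). implements c g args r b) cs (zip gs rs)"
    and "length rs = length gs" "distinct rs" "set rs \<inter> set args = {}" "\<forall>r\<in>set rs. r < b"
  shows "\<exists>c. \<forall>s ys. list_all2 (\<lambda>g y. eval g (map s args) y) gs ys \<longrightarrow> (\<forall>r\<in>set rs. s r = 0) \<longrightarrow>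
    (\<forall>r\<ge>b. s r = 0) \<longrightarrow> (\<exists>t. bigstep c s t \<and> map t rs = ys \<and> (\<forall>r. r \<notin> set rs \<longrightarrow> t r = s r))"
  using assms
proof (induction gs arbitrary: cs rs)
  case Nil
  then show ?case
    by (intro exI[of _ "skip b"] allI impI) (auto intro: bigstep_skip)
next
  case (Cons g gs)
  from Cons.prems(2) obtain r rs' where rs: "rs = r # rs'" by (cases rs) auto
  from Cons.prems rs obtain c cs' where cs: "cs = c # cs'" "implements c g args r b"
    "list_all2 (\<lambda>c (g, r). implements c g args r b) cs' (zip gs rs')"
    by (auto simp: list_all2_Cons2)
  obtain d where d: "\<forall>s ys. list_all2 (\<lambda>g y. eval g (map s args) y) gs ys \<longrightarrow> (\<forall>r\<in>set rs'. s r = 0) \<longrightarrow>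
    (\<forall>r\<ge>b. s r = 0) \<longrightarrow> (\<exists>t. bigstep d s t \<and> map t rs' = ys \<and> (\<forall>r. r \<notin> set rs' \<longrightarrow> t r = s r))"
    using Cons.IH[OF cs(3)] Cons.prems rs by auto
  show ?case
  proof (intro exI[of _ "Seq c d"] allI impI)
    fix s zs
    assume *: "list_all2 (\<lambda>g y. eval g (map s args) y) (g # gs) zs"
      "\<forall>r\<in>set rs. s r = 0" "\<forall>r\<ge>b. s r = 0"
    then obtain y ys where zs: "zs = y # ys" and y: "eval g (map s args) y"
      and ys: "list_all2 (\<lambda>g y. eval g (map s args) y) gs ys"
      by (auto simp: list_all2_Cons1)
    let ?s = "s(r := y)"
    have 1: "bigstep c s ?s"
      using cs(2) y * rs unfolding implements_def by auto
    have "map ?s args = map s args" using Cons.prems rs by auto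
    then have "list_all2 (\<lambda>g y. eval g (map ?s args) y) gs ys" using ys by (simp only:)
    moreover have "\<forall>r\<in>set rs'. ?s r = 0" "\<forall>r\<ge>b. ?s r = 0" using * Cons.prems rs by auto
    ultimately obtain t where t: "bigstep d ?s t" "map t rs' = ys" "\<forall>r. r \<notin> set rs' \<longrightarrow> t r = ?s r"
      using d by blast
    then show "\<exists>t. bigstep (Seq c d) s t \<and> map t rs = zs \<and> (\<forall>r. r \<notin> set rs \<longrightarrow> t r = s r)"
      using 1 rs zs Cons.prems by (intro exI[of _ t]) (auto intro: Seq)
  qed
qed

theorem recf_implementable:
  assumes "\<forall>a\<in>set args. a < b" "res < b" "res \<notin> set args"
  shows "\<exists>c. implements c f args res b"
  using assms
proof (induction f arbitrary: args res b)
  case Zero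
  then show ?case
    by (intro exI[of _ "skip b"])
      (auto simp: implements_def skip_def elim!: eval_ZeroE intro!: bigstep_While0)
next
  case Succ
  show ?case
  proof (cases args)
    case Nil
    then show ?thesis by (auto simp: implements_def elim: eval_SuccE)
  next
    case (Cons a as)
    have "bigstep (Seq (copy b a res) (Inc res)) s (s(res := Suc (s a)))"
      if "s res = 0" "\<forall>r\<ge>b. s r = 0" for s
      using Succ Cons that bigstep_copy[of a res b s]
      by (intro Seq[of _ _ "s(res := s a)"] bigstep_Inc) auto
    then show ?thesis using Cons
      by (intro exI[of _ "Seq (copy b a res) (Inc res)"]) (auto simp: implements_def elim: eval_SuccE)
  qed
next
  case (Proj i)
  show ?case
  proof (cases "i < length args")
    case False
    then show ?thesis by (auto simp: implements_def elim!: eval_ProjE)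
  next
    case True
    then have a: "args ! i \<in> set args" by simp
    have "bigstep (copy b (args ! i) res) s (s(res := s (args ! i)))"
      if "s res = 0" "\<forall>r\<ge>b. s r = 0" for s
    proof -
      have "args ! i \<noteq> res" "b \<noteq> res" "args ! i \<noteq> b" using Proj a by auto
      from bigstep_copy[OF this, of s] that show ?thesis by simp
    qed
    then show ?thesis using True
      by (intro exI[of _ "copy b (args ! i) res"]) (auto simp: implements_def elim!: eval_ProjE)
  qed
next
  case (Comp f gs)
  define k where "k = length gs"
  \<comment> \<open>The first \<open>k\<close> scratch registers hold the values of the inner
    functions; the scratch space of the subprograms begins after them.\<close>
  define rs where "rs = [b..<b + k]"
  have "\<exists>c. implements c g args r (b + k)" if "g \<in> set gs" "r \<in> set rs" for g r
    using Comp.prems that by (intro Comp.IH(2)) (auto simp: rs_def)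
  then have "\<forall>p\<in>set (zip gs rs). \<exists>c. implements c (fst p) args (snd p) (b + k)"
    by (auto simp: set_zip)
  then obtain C where C: "\<forall>p\<in>set (zip gs rs). implements (C p) (fst p) args (snd p) (b + k)"
    by metis
  have rs: "length rs = length gs" "distinct rs" "set rs \<inter> set args = {}" "\<forall>r\<in>set rs. r < b + k"
    using Comp.prems by (auto simp: rs_def k_def)
  have "list_all2 (\<lambda>c (g, r). implements c g args r (b + k)) (map C (zip gs rs)) (zip gs rs)"
    using C by (auto simp: list.rel_map intro!: list.rel_refl_strong split: prod.splits)
  from implements_list[OF this rs] obtain c where c:
    "\<forall>s ys. list_all2 (\<lambda>g y. eval g (map s args) y) gs ys \<longrightarrow> (\<forall>r\<in>set rs. s r = 0) \<longrightarrow>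
    (\<forall>r\<ge>b + k. s r = 0) \<longrightarrow> (\<exists>t. bigstep c s t \<and> map t rs = ys \<and> (\<forall>r. r \<notin> set rs \<longrightarrow> t r = s r))"
    by blast
  obtain d where d: "implements d f rs res (b + k)"
    using Comp.IH(1)[of rs "b + k" res] Comp.prems by (auto simp: rs_def)
  have "bigstep (Seq c (Seq d (clears (b + k) rs))) s (s(res := z))"
    if ev: "eval (Comp f gs) (map s args) z" and s: "s res = 0" "\<forall>r\<ge>b. s r = 0" for s z
  proof -
    from ev obtain ys where ys: "list_all2 (\<lambda>g y. eval g (map s args) y) gs ys" "eval f ys z"
      by (auto elim: eval_CompE)
    have "(\<forall>r\<in>set rs. s r = 0)" "(\<forall>r\<ge>b + k. s r = 0)" using s by (auto simp: rs_def)
    then obtain t where t: "bigstep c s t" "map t rs = ys" "\<forall>r. r \<notin> set rs \<longrightarrow> t r = s r"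
      using c ys(1) by blast
    have "t res = 0" "\<forall>r\<ge>b + k. t r = 0" using t(3) s Comp.prems by (auto simp: rs_def)
    then have 2: "bigstep d t (t(res := z))" using d ys(2) t(2) by (auto simp: implements_def)
    have "bigstep (clears (b + k) rs) (t(res := z)) (\<lambda>r. if r \<in> set rs then 0 else (t(res := z)) r)"
      using s t(3) Comp.prems by (intro bigstep_clears) (auto simp: rs_def)
    also have "(\<lambda>r. if r \<in> set rs then 0 else (t(res := z)) r) = s(res := z)"
      using t(3) s Comp.prems by (auto simp: rs_def fun_eq_iff)
    finally show ?thesis using t(1) 2 by (blast intro: Seq)
  qed
  then show ?case by (auto simp: implements_def)
next
  case (Prim g h)
  show ?case
  proof (cases args)
    case Nil
    then show ?thesis by (auto simp: implements_def elim: eval_PrimE)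
  next
    case (Cons a as)
    obtain c where c: "implements c g as res (b + 3)"
      using Prim.IH(1)[of as "b + 3" res] Prim.prems Cons by fastforce
    obtain d where d: "implements d h (b # res # as) (Suc b) (b + 3)"
      using Prim.IH(2)[of "b # res # as" "b + 3" "Suc b"] Prim.prems Cons by fastforce
    \<comment> \<open>\<open>b\<close> is the round number, \<open>res\<close> the accumulator,
      \<open>Suc b\<close> receives its next value, \<open>b + 2\<close> counts the remaining
      rounds, and \<open>b + 3\<close> is a zero register for the auxiliary programs.\<close>
    define body where "body = Seq d (Seq (clear (b + 3) res) (Seq (move (Suc b) res) (Inc b)))"
    define prg where "prg = Seq c (Seq (copy (b + 3) a (b + 2)) (Seq (While (b + 2) body) (clear (b + 3) b)))"
    have ne: "res \<noteq> b" "res \<noteq> Suc b" "res \<noteq> b + 2" "res \<noteq> b + 3" "res \<noteq> Suc (Suc b)"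
      "a \<noteq> b" "a \<noteq> Suc b" "a \<noteq> b + 2" "a \<noteq> b + 3" "a \<noteq> Suc (Suc b)" "a \<noteq> res"
      using Prim.prems Cons by auto
    have "bigstep prg s (s(res := z))"
      if ev: "eval (Prim g h) (map s args) z" and s: "s res = 0" "\<forall>r\<ge>b. s r = 0" for s z
    proof -
      from ev Cons obtain F where F: "eval g (map s as) (F 0)"
        "\<forall>i<s a. eval h (i # F i # map s as) (F (Suc i))" "F (s a) = z"
        using eval_Prim_sequence by fastforce
      have as: "map (s(res := x, b := y, b + 2 := z)) as = map s as" for x y z
        using Prim.prems Cons by auto
      have body: "bigstep body (s(res := F i, b := i, b + 2 := m))
            (s(res := F (Suc i), b := Suc i, b + 2 := m))" if "i < s a" for i m
      proof -
        let ?s = "s(res := F i, b := i, b + 2 := m)"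
        have 1: "bigstep d ?s (?s(Suc b := F (Suc i)))"
        proof -
          have "map ?s (b # res # as) = i # F i # map s as" using as ne by simp
          then have "eval h (map ?s (b # res # as)) (F (Suc i))" using F(2) that by (simp only:)
          moreover have "?s (Suc b) = 0" "\<forall>r\<ge>b + 3. ?s r = 0" using s Prim.prems by auto
          ultimately show ?thesis using d unfolding implements_def by blast
        qed
        let ?t = "?s(Suc b := F (Suc i))"
        have 2: "bigstep (clear (b + 3) res) ?t (?t(res := 0))"
          using s ne by (intro bigstep_clear) auto
        let ?u = "?t(res := 0)"
        have 3: "bigstep (move (Suc b) res) ?u (?u(Suc b := 0, res := ?u res + ?u (Suc b)))"
          using ne by (intro bigstep_move) auto
        have 4: "bigstep (Inc b) (?u(Suc b := 0, res := ?u res + ?u (Suc b)))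
           (s(res := F (Suc i), b := Suc i, b + 2 := m))"
          using ne s by (intro bigstep_Inc) (auto simp: fun_eq_iff)
        show ?thesis unfolding body_def using 1 2 3 4 by (blast intro: Seq)
      qed
      have loop: "bigstep (While (b + 2) body) (s(res := F i, b := i, b + 2 := m))
          (s(res := F (i + m), b := i + m, b + 2 := 0))" if "i + m = s a" for i m
        using that
      proof (induction m arbitrary: i)
        case 0
        then show ?case by (auto intro: While0)
      next
        case (Suc m)
        have rest: "bigstep (While (b + 2) body) (s(res := F (Suc i), b := Suc i, b + 2 := m))
          (s(res := F (i + Suc m), b := i + Suc m, b + 2 := 0))"
          using Suc.IH[of "Suc i"] Suc.prems by (simp only: add_Suc add_Suc_right)
        have "bigstep body ((s(res := F i, b := i, b + 2 := Suc m))(b + 2 := m))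
            (s(res := F (Suc i), b := Suc i, b + 2 := m))"
          using body[of i m] Suc.prems by simp
        then show ?case by (rule WhileS[OF _ _ rest, rotated]) simp
      qed
      have 1: "bigstep c s (s(res := F 0))"
        using c F(1) s by (auto simp: implements_def)
      have "bigstep (copy (b + 3) a (b + 2)) (s(res := F 0))
         ((s(res := F 0))(b + 2 := (s(res := F 0)) (b + 2) + (s(res := F 0)) a))"
        using ne s by (intro bigstep_copy) auto
      also have "(s(res := F 0))(b + 2 := (s(res := F 0)) (b + 2) + (s(res := F 0)) a)
           = s(res := F 0, b := 0, b + 2 := s a)"
        using ne s by (auto simp: fun_eq_iff)
      finally have 2: "bigstep (copy (b + 3) a (b + 2)) (s(res := F 0))
        (s(res := F 0, b := 0, b + 2 := s a))" .
      have 3: "bigstep (While (b + 2) body) (s(res := F 0, b := 0, b + 2 := s a))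
          (s(res := z, b := s a, b + 2 := 0))" using loop[of 0 "s a"] F(3) by simp
      let ?t = "s(res := z, b := s a, b + 2 := 0)"
      have "bigstep (clear (b + 3) b) ?t (?t(b := 0))"
        using ne s by (intro bigstep_clear) auto
      also have "?t(b := 0) = s(res := z)" using ne s by (auto simp: fun_eq_iff)
      finally show ?thesis unfolding prg_def using 1 2 3 by (blast intro: Seq)
    qed
    then show ?thesis by (auto simp: implements_def)
  qed
next
  case (Mn f)
  obtain c where c: "implements c f (res # args) b (b + 1)"
    using Mn.IH[of "res # args" "b + 1" b] Mn.prems by fastforce
  \<comment> \<open>\<open>b\<close> holds the value of \<open>f\<close> at \<open>res\<close>. The
    search ends exactly when this value is zero, so \<open>b\<close> is then already clean.\<close>
  define loop where "loop = While b (Seq (clear (b + 1) b) (Seq (Inc res) c))"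
  have "bigstep (Seq c loop) s (s(res := z))"
    if ev: "eval (Mn f) (map s args) z" and s: "s res = 0" "\<forall>r\<ge>b. s r = 0" for s z
  proof -
    from ev have z: "eval f (z # map s args) 0" "\<forall>i<z. \<exists>y. eval f (i # map s args) y \<and> 0 < y"
      by (auto elim: eval_MnE)
    have ne: "res \<noteq> b" "res \<noteq> b + 1" "res \<noteq> Suc b" using Mn.prems by auto
    have c': "bigstep c (s(res := i)) (s(res := i, b := y))" if "eval f (i # map s args) y" for i y
    proof -
      have "map (s(res := i)) (res # args) = i # map s args" using Mn.prems by auto
      then have "eval f (map (s(res := i)) (res # args)) y" using that by (simp only:)
      moreover have "(s(res := i)) b = 0" "\<forall>r\<ge>b + 1. (s(res := i)) r = 0" using s ne Mn.prems by auto
      ultimately show ?thesis using c unfolding implements_def by blast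
    qed
    \<comment> \<open>Below \<open>z\<close>, \<open>eval_Mn\<close> yields only some positive
      value, so the invariant records just whether \<open>y\<close> vanishes.\<close>
    have loop: "bigstep loop (s(res := i, b := y)) (s(res := z))"
      if "i \<le> z" "y = 0 \<longleftrightarrow> i = z" for i y
      using that
    proof (induction "z - i" arbitrary: i y)
      case 0
      then show ?case
        using s ne unfolding loop_def by (intro bigstep_While0) (auto simp: fun_eq_iff)
    next
      case (Suc m)
      then obtain n where n: "y = Suc n" by (cases y) auto
      obtain y' where y': "eval f (Suc i # map s args) y'" "y' = 0 \<longleftrightarrow> Suc i = z"
        using z Suc by (cases "Suc i = z") (auto, metis Suc_lessI less_numeral_extra(3) zero_less_Suc zero_less_diff)
      let ?s = "s(res := i, b := n)"
      have "bigstep (clear (b + 1) b) ?s (?s(b := 0))"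
        using s ne by (intro bigstep_clear) auto
      moreover have "bigstep (Inc res) (?s(b := 0)) (s(res := Suc i))"
        using s ne by (intro bigstep_Inc) (auto simp: fun_eq_iff)
      ultimately have "bigstep (Seq (clear (b + 1) b) (Seq (Inc res) c)) ?s (s(res := Suc i, b := y'))"
        using c'[OF y'(1)] by (blast intro: Seq)
      then have body: "bigstep (Seq (clear (b + 1) b) (Seq (Inc res) c)) ((s(res := i, b := y))(b := n))
          (s(res := Suc i, b := y'))" by simp
      have "bigstep loop (s(res := Suc i, b := y')) (s(res := z))"
        using Suc y'(2) by (intro Suc.hyps) auto
      then show ?case
        unfolding loop_def using n by (intro WhileS[OF _ body]) simp_all
    qed
    obtain y where y: "eval f (0 # map s args) y" "y = 0 \<longleftrightarrow> 0 = z"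
      using z by (cases "z = 0") auto
    have "bigstep c s (s(res := 0, b := y))" using c'[OF y(1)] s by (simp add: fun_upd_idem)
    then show ?thesis using loop[of 0 y] y(2) by (blast intro: Seq)
  qed
  then show ?case by (auto simp: implements_def)
qed

section \<open>Counter machines\<close>

datatype instr = IInc nat nat | IDec nat nat nat

type_synonym cmachine = "(nat \<times> instr) list"

inductive mstep :: "cmachine \<Rightarrow> nat \<times> (nat \<Rightarrow> nat) \<Rightarrow> nat \<times> (nat \<Rightarrow> nat) \<Rightarrow> bool" for R where
  mstep_inc: "(q, IInc r q') \<in> set R \<Longrightarrow> mstep R (q, s) (q', s(r := Suc (s r)))"
| mstep_dec: "(q, IDec r q1 q2) \<in> set R \<Longrightarrow> s r = Suc n \<Longrightarrow> mstep R (q, s) (q1, s(r := n))"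
| mstep_zero: "(q, IDec r q1 q2) \<in> set R \<Longrightarrow> s r = 0 \<Longrightarrow> mstep R (q, s) (q2, s)"

definition mhalts :: "cmachine \<Rightarrow> nat \<Rightarrow> nat \<Rightarrow> bool" where
  "mhalts R q h \<longleftrightarrow> (\<exists>s. (mstep R)\<^sup>*\<^sup>* (q, \<lambda>_. 0) (h, s))"

lemma mstep_source: "mstep R c c' \<Longrightarrow> fst c \<in> fst ` set R"
  by (force elim: mstep.cases)

lemma mstep_deterministic:
  assumes "distinct (map fst R)" "mstep R c c1" "mstep R c c2"
  shows "c1 = c2"
proof -
  note lookup = map_of_is_SomeI[OF assms(1)]
  show ?thesis using assms(2,3) by (auto elim!: mstep.cases dest!: lookup)
qed

text \<open>By determinism every point reachable from \<open>a\<close> lies on the path to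
  \<open>h\<close>, which cannot be prolonged beyond \<open>h\<close>.\<close>

lemma rtranclp_deterministic_terminal:
  assumes det: "\<And>x y z. r x y \<Longrightarrow> r x z \<Longrightarrow> y = z" and final: "\<And>x. \<not> r h x"
    and "r\<^sup>*\<^sup>* a b" "r\<^sup>*\<^sup>* a h"
  shows "r\<^sup>*\<^sup>* b h"
  using assms(3,4)
proof (induction rule: rtranclp_induct)
  case base
  then show ?case .
next
  case (step y z)
  then show ?case by (metis converse_rtranclpE det final)
qed

section \<open>Compilation of counter programs into machines\<close>

fun code_size :: "com \<Rightarrow> nat" where
  "code_size (Inc r) = 1"
| "code_size (Seq c d) = code_size c + code_size d"
| "code_size (While r c) = Suc (code_size c)"

text \<open>The code of \<open>c\<close> occupies the labels from \<open>i\<close> on and leaves to the label \<open>j\<close>.\<close>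

fun compile :: "com \<Rightarrow> nat \<Rightarrow> nat \<Rightarrow> cmachine" where
  "compile (Inc r) i j = [(i, IInc r j)]"
| "compile (Seq c d) i j = compile c i (i + code_size c) @ compile d (i + code_size c) j"
| "compile (While r c) i j = (i, IDec r (Suc i) j) # compile c (Suc i) i"

lemma code_size_pos: "0 < code_size c"
  by (induction c) auto

lemma labels_compile: "map fst (compile c i j) = [i..<i + code_size c]"
proof (induction c arbitrary: i j)
  case (Seq c d)
  then show ?case by (simp add: upt_add_eq_append[of i "i + code_size c" "code_size d"] flip: add.assoc)
next
  case (While r c)
  then show ?case by (simp add: upt_conv_Cons)
qed simp

text \<open>This will bound the states of the automaton. As no code block is empty, the label
  between two parts of a sequence and the entry of a loop body lie inside the block.\<close>

lemma compile_targets: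
  assumes "(q, ins) \<in> set (compile c i j)"
  shows "case ins of IInc r q' \<Rightarrow> q' \<in> {i..<i + code_size c} \<union> {j}
       | IDec r q1 q2 \<Rightarrow> q1 \<in> {i..<i + code_size c} \<union> {j} \<and> q2 \<in> {i..<i + code_size c} \<union> {j}"
  using assms
proof (induction c arbitrary: i j)
  case (Seq c d)
  from Seq.prems consider "(q, ins) \<in> set (compile c i (i + code_size c))"
    | "(q, ins) \<in> set (compile d (i + code_size c) j)" by auto
  then show ?case
    using Seq.IH[of i "i + code_size c"] Seq.IH(2)[of "i + code_size c" j] code_size_pos[of d]
    by cases (fastforce split: instr.splits)+
next
  case (While r c)
  then show ?case
    using While.IH[of "Suc i" i] code_size_pos[of c] by (fastforce split: instr.splits)
qed auto

lemma compile_correct: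
  "bigstep c s t \<Longrightarrow> set (compile c i j) \<subseteq> set R \<Longrightarrow> (mstep R)\<^sup>*\<^sup>* (i, s) (j, t)"
proof (induction arbitrary: i j rule: bigstep.induct)
  case (Inc r s)
  then have "(i, IInc r j) \<in> set R" by simp
  then show ?case by (blast intro: mstep_inc)
next
  case (Seq c s t d u)
  then have "(mstep R)\<^sup>*\<^sup>* (i, s) (i + code_size c, t)" "(mstep R)\<^sup>*\<^sup>* (i + code_size c, t) (j, u)"
    by simp_all
  then show ?case by (rule rtranclp_trans)
next
  case (While0 s r c)
  then show ?case by (auto intro: mstep_zero)
next
  case (WhileS s r n c t u)
  have "mstep R (i, s) (Suc i, s(r := n))"
    using WhileS by (auto intro: mstep_dec)
  moreover have "(mstep R)\<^sup>*\<^sup>* (Suc i, s(r := n)) (i, t)"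
    using WhileS.prems by (intro WhileS.IH(1)) simp
  moreover have "(mstep R)\<^sup>*\<^sup>* (i, t) (j, u)"
    using WhileS by auto
  ultimately show ?case by (meson converse_rtranclp_into_rtranclp rtranclp_trans)
qed

text \<open>The concluding loop \<open>While r (Inc r)\<close> diverges unless \<open>r\<close> is zero.\<close>

lemma mhalts_compile_guarded:
  assumes R: "set (compile (Seq c (While r (Inc r))) 0 h) \<subseteq> set R" "distinct (map fst R)"
      "h \<notin> fst ` set R"
    and start: "(mstep R)\<^sup>*\<^sup>* (q, \<lambda>_. 0) (0, s)" and c: "bigstep c s t"
  shows "mhalts R q h \<longleftrightarrow> t r = 0"
proof -
  let ?l = "code_size c"
  have l: "(?l, IDec r (Suc ?l) h) \<in> set R" "(Suc ?l, IInc r ?l) \<in> set R"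
    and run: "(mstep R)\<^sup>*\<^sup>* (q, \<lambda>_. 0) (?l, t)"
    using R start compile_correct[OF c, of 0 ?l R] by auto
  note det = mstep_deterministic[OF R(2)]
  show ?thesis
  proof
    assume "t r = 0"
    then have "mstep R (?l, t) (h, t)" using l by (auto intro: mstep_zero)
    then show "mhalts R q h" using run by (auto simp: mhalts_def intro: rtranclp.rtrancl_into_rtrancl)
  next
    assume "mhalts R q h"
    then obtain u where u: "(mstep R)\<^sup>*\<^sup>* (q, \<lambda>_. 0) (h, u)" by (auto simp: mhalts_def)
    have noh: "\<not> mstep R (h, u) x" for x using R(3) mstep_source[of R "(h, u)" x] by auto
    have "(mstep R)\<^sup>*\<^sup>* (?l, t) (h, u)"
      by (rule rtranclp_deterministic_terminal[OF _ noh run u]) (rule det)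
    \<comment> \<open>With \<open>r\<close> positive, the guard alternates between \<open>?l\<close>
      and \<open>Suc ?l\<close>, decrementing and restoring \<open>r\<close>, so by determinism it
      never reaches \<open>h\<close>.\<close>
    moreover have "fst x = ?l \<and> 0 < snd x r \<or> fst x = Suc ?l"
      if "(mstep R)\<^sup>*\<^sup>* (?l, t) x" "0 < t r" for x
      using that
    proof (induction rule: rtranclp_induct)
      case (step y z)
      obtain p v where y: "y = (p, v)" by fastforce
      show ?case
      proof (cases "p = ?l \<and> 0 < v r")
        case True
        then obtain n where "v r = Suc n" by (cases "v r") auto
        then have "mstep R y (Suc ?l, v(r := n))" using l y True by (auto intro: mstep_dec)
        then have "z = (Suc ?l, v(r := n))" using det step.hyps(2) by blast
        then show ?thesis by simp
      next
        case False
        then have "p = Suc ?l" using y step by auto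
        then have "mstep R y (?l, v(r := Suc (v r)))" using l y by (blast intro: mstep_inc)
        then have "z = (?l, v(r := Suc (v r)))" using det step.hyps(2) by blast
        then show ?thesis by simp
      qed
    qed simp
    moreover have "h \<noteq> ?l" "h \<noteq> Suc ?l" using l R(3) by force+
    ultimately show "t r = 0" by fastforce
  qed
qed

section \<open>The automaton of a counter machine\<close>

text \<open>Letter 0 stands for an increment, 1 for a decrement and 2 for a successful zero test; the
  register concerned is determined by the control state. In a correct word every increment of
  \<open>r\<close> uses a datum that is not yet in \<open>insset r\<close>, and every decrement of \<open>r\<close> uses a datum
  that is in \<open>insset r\<close> but not yet in \<open>delset r\<close>; the value of \<open>r\<close> is the number of data in
  the difference of both sets. The automaton accepts the words with an error.
  The state \<open>E q 0\<close> simulates the control state \<open>q\<close>. In state \<open>E q (Suc r)\<close> it has moreover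
  guessed an increment of \<open>r\<close>, stored its datum in set 1, and waits for a zero test of \<open>r\<close> that
  comes without a decrement with the same datum. State 1 accepts everything, state 2 only the
  empty word. Set 0 remains empty, so that \<open>always\<close> is a vacuous condition.\<close>

definition insset :: "nat \<Rightarrow> nat" where "insset r = 2 * r + 2"
definition delset :: "nat \<Rightarrow> nat" where "delset r = 2 * r + 3"
abbreviation always :: cond where "always \<equiv> (False, 0)"

lemma set_names [simp]:
  "insset r = insset r' \<longleftrightarrow> r = r'" "delset r = delset r' \<longleftrightarrow> r = r'"
  "insset r \<noteq> delset r'" "delset r' \<noteq> insset r"
  "insset r \<noteq> 0" "insset r \<noteq> Suc 0" "delset r \<noteq> 0" "delset r \<noteq> Suc 0"
  "0 \<noteq> insset r" "Suc 0 \<noteq> insset r" "0 \<noteq> delset r" "Suc 0 \<noteq> delset r"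
  unfolding insset_def delset_def by presburger+

text \<open>Transitions from mode 0 into state 1 report an error at the current letter, those into
  state 2 that the word ends with it, too early. The step into the halting state has one of the
  latter as well, which is why a correct word must go on for another letter. In a guess mode only a
  zero test of the guessed register is reported, as a branch in mode 0 reads the same word and sees
  the other errors. A decrement with the guessed datum blocks the branch, refuting the
  guess.\<close>

fun instr_trans :: "(nat \<Rightarrow> nat \<Rightarrow> nat) \<Rightarrow> nat list \<Rightarrow> nat \<times> instr \<Rightarrow> trans list" where
  "instr_trans E ms (q, IInc r q') =
    [(E q 0, 0, always, Some (insset r), E q' 0),
     (E q 0, 0, (True, insset r), None, 1),
     (E q 0, 1, always, None, 1),
     (E q 0, 2, always, None, 1),
     (E q 0, 0, always, Some 1, E q' (Suc r)),
     (E q 0, 0, always, None, 2)] @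
    map (\<lambda>m. (E q m, 0, always, None, E q' m)) ms"
| "instr_trans E ms (q, IDec r q1 q2) =
    [(E q 0, 1, always, Some (delset r), E q1 0),
     (E q 0, 1, (False, insset r), None, 1),
     (E q 0, 1, (True, delset r), None, 1),
     (E q 0, 1, always, None, 2),
     (E q 0, 2, always, None, E q2 0),
     (E q 0, 2, always, None, 2),
     (E q 0, 0, always, None, 1)] @
    map (\<lambda>m. (E q m, 1, if m = Suc r then (False, 1) else always, None, E q1 m)) ms @
    map (\<lambda>m. (E q m, 2, always, None, if m = Suc r then 1 else E q2 m)) ms"

text \<open>A correct word has one additional final letter, which leads from the halting state to the
  rejecting state \<open>E (Suc h) 0\<close>.\<close>

definition final_trans :: "(nat \<Rightarrow> nat \<Rightarrow> nat) \<Rightarrow> nat \<Rightarrow> trans list" where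
  "final_trans E h =
    [(E h 0, 0, always, None, E (Suc h) 0),
     (E h 0, 1, always, None, 1),
     (E h 0, 2, always, None, 1)] @
    map (\<lambda>a. (E (Suc h) 0, a, always, None, 1)) [0, 1, 2] @
    map (\<lambda>a. (1, a, always, None, 1)) [0, 1, 2]"

section \<open>Acceptance from an arbitrary configuration\<close>

definition acc :: "safa \<Rightarrow> (nat \<times> nat) list \<Rightarrow> config \<Rightarrow> bool" where
  "acc M w c \<longleftrightarrow> (\<exists>c'\<in>reach M w c. fst c' \<in> set (finals M))"

lemma acc_Nil [simp]: "acc M [] c \<longleftrightarrow> fst c \<in> set (finals M)"
  by (simp add: acc_def)

lemma acc_Cons: "acc M (x # w) c \<longleftrightarrow> (\<exists>c'. step M x c c' \<and> acc M w c')"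
  by (auto simp: acc_def)

lemma acc_trans:
  "(q, a, \<alpha>, op, q') \<in> set (delta M) \<Longrightarrow> holds \<alpha> S d \<Longrightarrow> acc M w (q', apply_op op S d)
     \<Longrightarrow> acc M ((a, d) # w) (q, S)"
  unfolding acc_Cons step_def by (metis fst_conv snd_conv)

lemma acc_letters:
  assumes "wf_safa M" "acc M w c"
  shows "\<forall>x\<in>set w. fst x < n_syms M"
  using assms(2)
proof (induction w arbitrary: c)
  case (Cons x w)
  then obtain c' where "step M x c c'" "acc M w c'" by (auto simp: acc_Cons)
  from this(1) obtain \<alpha> op where "(fst c, fst x, \<alpha>, op, fst c') \<in> set (delta M)"
    by (auto simp: step_def)
  then have "fst x < n_syms M" using assms(1) by (cases \<alpha>) (auto simp: wf_safa_def)
  with Cons.IH[OF \<open>acc M w c'\<close>] show ?case by simp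
qed simp

text \<open>\<open>E\<close> and \<open>ms\<close> are parameters because program labels and loading
  labels will be numbered differently and carry different guess modes. \<open>ms q\<close> lists the
  modes possible at \<open>q\<close> and must not shrink along jumps, so that no guess is lost. As
  \<open>start\<close> is a label of \<open>R\<close>, it differs from \<open>Suc h\<close>, so its
  state can be final, for the empty word, while \<open>E (Suc h) 0\<close> rejects.\<close>

locale machine_safa =
  fixes R :: cmachine and E :: "nat \<Rightarrow> nat \<Rightarrow> nat" and ms :: "nat \<Rightarrow> nat list"
    and start h :: nat and M :: safa
  assumes distinct: "distinct (map fst R)"
    and halt: "h \<notin> fst ` set R" "Suc h \<notin> fst ` set R"
    and inj: "\<And>q m q' m'. E q m = E q' m' \<Longrightarrow>
        q \<in> fst ` set R \<union> {h, Suc h} \<Longrightarrow> m \<in> insert 0 (set (ms q)) \<Longrightarrow>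
        q' \<in> fst ` set R \<union> {h, Suc h} \<Longrightarrow> m' \<in> insert 0 (set (ms q')) \<Longrightarrow> q = q' \<and> m = m'"
    and special: "\<And>q m. q \<in> fst ` set R \<union> {h, Suc h} \<Longrightarrow> m \<in> insert 0 (set (ms q)) \<Longrightarrow>
        E q m \<noteq> 1 \<and> E q m \<noteq> 2"
    and target_inc: "\<And>q r q'. (q, IInc r q') \<in> set R \<Longrightarrow>
        q' \<in> fst ` set R \<union> {h} \<and> Suc r \<in> set (ms q') \<and> set (ms q) \<subseteq> set (ms q')"
    and target_dec: "\<And>q r q1 q2. (q, IDec r q1 q2) \<in> set R \<Longrightarrow>
        q1 \<in> fst ` set R \<union> {h} \<and> set (ms q) \<subseteq> set (ms q1) \<and>
        q2 \<in> fst ` set R \<union> {h} \<and> set (ms q) \<subseteq> set (ms q2)"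
    and modes: "\<And>q. 0 \<notin> set (ms q)"
    and start: "start \<in> fst ` set R"
    and delta: "set (delta M) = (\<Union>(q, i)\<in>set R. set (instr_trans E (ms q) (q, i))) \<union> set (final_trans E h)"
    and init: "init M = E start 0"
    and finals: "set (finals M) = {E start 0, 1, 2}"
begin

section \<open>Rejected words describe halting runs\<close>

lemma delta_instr: "(q, i) \<in> set R \<Longrightarrow> t \<in> set (instr_trans E (ms q) (q, i)) \<Longrightarrow> t \<in> set (delta M)"
  unfolding delta by blast

lemma holds_always [simp]: "holds always S d \<longleftrightarrow> d \<notin> S 0"
  by (simp add: holds_def)

lemma acc_sink: "\<forall>x\<in>set w. fst x < 3 \<Longrightarrow> S 0 = {} \<Longrightarrow> acc M w (1, S)"
proof (induction w)
  case Nil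
  then show ?case by (simp add: finals)
next
  case (Cons x w)
  obtain a d where x: "x = (a, d)" by fastforce
  then have "a = 0 \<or> a = 1 \<or> a = 2" using Cons.prems by auto
  then have "(1, a, always, None, 1) \<in> set (delta M)" by (auto simp: delta final_trans_def)
  then show ?case
    using Cons x by (auto intro!: acc_trans simp: apply_op_def)
qed

text \<open>Rejection rules out each error in turn, so the letters dictate the steps of the machine.
  The invariant keeps, for every datum inserted into a register but not yet removed, a rejecting
  branch that guessed it; the branch is described by sets 0 and 1 alone, since guess modes test no
  other set and change none.\<close>

lemma rejected_imp_halts:
  assumes "w \<noteq> []" "\<forall>x\<in>set w. fst x < 3" "q \<in> fst ` set R \<union> {h}" "\<not> acc M w (E q 0, S)"
    and "\<And>r d. d \<in> S (insset r) \<Longrightarrow> d \<notin> S (delset r) \<Longrightarrow>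
      Suc r \<in> set (ms q) \<and> (\<exists>S'. S' 0 = {} \<and> S' 1 = {d} \<and> \<not> acc M w (E q (Suc r), S'))"
    and "S 0 = {}" "S 1 = {}" "\<And>r. finite (S (insset r))" "\<And>r. S (delset r) \<subseteq> S (insset r)"
    and "\<And>r. s r = card (S (insset r) - S (delset r))"
  shows "\<exists>t. (mstep R)\<^sup>*\<^sup>* (q, s) (h, t)"
  using assms
proof (induction w arbitrary: q S s)
  case Nil
  then show ?case by simp
next
  case (Cons x w)
  note prems = Cons.prems
  obtain a d where x: "x = (a, d)" by fastforce
  then have a: "a = 0 \<or> a = 1 \<or> a = 2" using prems(2) by auto
  have w: "\<forall>x\<in>set w. fst x < 3" using prems(2) by simp
  have sink: "acc M w (1, S')" if "S' 0 = {}" for S' using acc_sink[of w S'] w that by blast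
  show ?case
  proof (cases "q = h")
    case True
    then show ?thesis by blast
  next
    case False
    then obtain i where i: "(q, i) \<in> set R" using prems(3) by auto
    note tr = acc_trans[OF delta_instr[OF i]]
    show ?thesis
    proof (cases i)
      case (IInc r q')
      have a0: "a = 0"
      proof (rule ccontr)
        assume "a \<noteq> 0"
        then have "acc M (x # w) (E q 0, S)"
          using a prems(6) sink[of S] unfolding x
          by (intro tr[of _ _ always None 1]) (auto simp: IInc apply_op_def)
        then show False using prems(4) by simp
      qed
      have fresh: "d \<notin> S (insset r)"
      proof
        assume "d \<in> S (insset r)"
        then have "acc M (x # w) (E q 0, S)"
          using a0 prems(6) sink[of S] unfolding x
          by (intro tr[of _ _ "(True, insset r)" None 1]) (auto simp: IInc apply_op_def holds_def)
        then show False using prems(4) by simp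
      qed
      have "\<not> acc M w (2, S)"
      proof
        assume "acc M w (2, S)"
        then have "acc M (x # w) (E q 0, S)"
          using a0 prems(6) unfolding x
          by (intro tr[of _ _ always None 2]) (auto simp: IInc apply_op_def)
        then show False using prems(4) by simp
      qed
      then have w0: "w \<noteq> []" by (auto simp: finals)
      define S1 where "S1 = S(insset r := insert d (S (insset r)))"
      have target: "q' \<in> fst ` set R \<union> {h}" "Suc r \<in> set (ms q')" "set (ms q) \<subseteq> set (ms q')"
        using target_inc i IInc by auto
      have nacc: "\<not> acc M w (E q' 0, S1)"
      proof
        assume "acc M w (E q' 0, S1)"
        then have "acc M (x # w) (E q 0, S)"
          using a0 prems(6) unfolding x
          by (intro tr[of _ _ always "Some (insset r)" "E q' 0"]) (auto simp: IInc apply_op_def S1_def)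
        then show False using prems(4) by simp
      qed
      have guess: "Suc r' \<in> set (ms q') \<and> (\<exists>S'. S' 0 = {} \<and> S' 1 = {e} \<and> \<not> acc M w (E q' (Suc r'), S'))"
        if e: "e \<in> S1 (insset r')" "e \<notin> S1 (delset r')" for r' e
      proof (cases "e \<in> S (insset r')")
        case True
        then obtain S' where S': "Suc r' \<in> set (ms q)" "S' 0 = {}" "S' 1 = {e}"
          "\<not> acc M (x # w) (E q (Suc r'), S')"
          using prems(5)[OF True] e(2) by (auto simp: S1_def)
        have "\<not> acc M w (E q' (Suc r'), S')"
        proof
          assume "acc M w (E q' (Suc r'), S')"
          then have "acc M (x # w) (E q (Suc r'), S')"
            using a0 S' unfolding x
            by (intro tr[of _ _ always None "E q' (Suc r')"]) (auto simp: IInc apply_op_def)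
          then show False using S' by simp
        qed
        then show ?thesis using S' target by blast
      next
        case False
        \<comment> \<open>This datum has just been inserted, so its branch is the guess made at this
          letter.\<close>
        then have e: "e = d" "r' = r" using e by (auto simp: S1_def split: if_splits)
        have "\<not> acc M w (E q' (Suc r), S(1 := {d}))"
        proof
          assume "acc M w (E q' (Suc r), S(1 := {d}))"
          then have "acc M (x # w) (E q 0, S)"
            using a0 prems(6,7) unfolding x
            by (intro tr[of _ _ always "Some 1" "E q' (Suc r)"]) (auto simp: IInc apply_op_def)
          then show False using prems(4) by simp
        qed
        then show ?thesis using e target prems(6) by (intro conjI exI[of _ "S(1 := {d})"]) auto
      qed
      have s1: "(s(r := Suc (s r))) r' = card (S1 (insset r') - S1 (delset r'))" for r'
      proof -
        have "d \<notin> S (delset r)" using fresh prems(9)[of r] by blast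
        then have "insert d (S (insset r)) - S (delset r) = insert d (S (insset r) - S (delset r))" by blast
        then show ?thesis using fresh prems(8,10) by (auto simp: S1_def)
      qed
      have sub: "S1 (delset r') \<subseteq> S1 (insset r')" for r'
        using prems(9)[of r'] by (auto simp: S1_def)
      have "\<exists>t. (mstep R)\<^sup>*\<^sup>* (q', s(r := Suc (s r))) (h, t)"
        using prems(6-8) by (intro Cons.IH[OF w0 w target(1) nacc guess _ _ _ sub s1]) (auto simp: S1_def)
      moreover have "mstep R (q, s) (q', s(r := Suc (s r)))"
        using i IInc by (blast intro: mstep_inc)
      ultimately show ?thesis by (meson converse_rtranclp_into_rtranclp)
    next
      case (IDec r q1 q2)
      have target: "q1 \<in> fst ` set R \<union> {h}" "set (ms q) \<subseteq> set (ms q1)"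
         "q2 \<in> fst ` set R \<union> {h}" "set (ms q) \<subseteq> set (ms q2)"
        using target_dec i IDec by blast+
      have a0: "a \<noteq> 0"
      proof
        assume "a = 0"
        then have "acc M (x # w) (E q 0, S)"
          using prems(6) sink[of S] unfolding x
          by (intro tr[of _ _ always None 1]) (auto simp: IDec apply_op_def)
        then show False using prems(4) by simp
      qed
      have "\<not> acc M w (2, S)"
      proof
        assume "acc M w (2, S)"
        then have "acc M (x # w) (E q 0, S)"
          using a a0 prems(6) unfolding x
          by (intro tr[of _ _ always None 2]) (auto simp: IDec apply_op_def)
        then show False using prems(4) by simp
      qed
      then have w0: "w \<noteq> []" by (auto simp: finals)
      show ?thesis
      proof (cases "a = 1")
        case True
        have d1: "d \<in> S (insset r)"
        proof (rule ccontr)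
          assume "d \<notin> S (insset r)"
          then have "acc M (x # w) (E q 0, S)"
            using True prems(6) sink[of S] unfolding x
            by (intro tr[of _ _ "(False, insset r)" None 1]) (auto simp: IDec apply_op_def holds_def)
          then show False using prems(4) by simp
        qed
        have d2: "d \<notin> S (delset r)"
        proof
          assume "d \<in> S (delset r)"
          then have "acc M (x # w) (E q 0, S)"
            using True prems(6) sink[of S] unfolding x
            by (intro tr[of _ _ "(True, delset r)" None 1]) (auto simp: IDec apply_op_def holds_def)
          then show False using prems(4) by simp
        qed
        define S1 where "S1 = S(delset r := insert d (S (delset r)))"
        have nacc: "\<not> acc M w (E q1 0, S1)"
        proof
          assume "acc M w (E q1 0, S1)"
          then have "acc M (x # w) (E q 0, S)"
            using True prems(6) unfolding x
            by (intro tr[of _ _ always "Some (delset r)" "E q1 0"]) (auto simp: IDec apply_op_def S1_def)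
          then show False using prems(4) by simp
        qed
        have guess: "Suc r' \<in> set (ms q1) \<and> (\<exists>S'. S' 0 = {} \<and> S' 1 = {e} \<and> \<not> acc M w (E q1 (Suc r'), S'))"
          if e: "e \<in> S1 (insset r')" "e \<notin> S1 (delset r')" for r' e
        proof -
          obtain S' where S': "Suc r' \<in> set (ms q)" "S' 0 = {}" "S' 1 = {e}"
            "\<not> acc M (x # w) (E q (Suc r'), S')"
            using prems(5)[of e r'] e by (auto simp: S1_def split: if_splits)
          \<comment> \<open>Removing \<open>e\<close> itself would put it into
            \<open>S1 (delset r)\<close>, so its branch passes the test against set 1.\<close>
          have ne: "r' = r \<Longrightarrow> d \<noteq> e" using e by (auto simp: S1_def)
          have "\<not> acc M w (E q1 (Suc r'), S')"
          proof
            assume "acc M w (E q1 (Suc r'), S')"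
            then have "acc M (x # w) (E q (Suc r'), S')"
              using True S' ne unfolding x
              by (intro tr[of _ _ "if Suc r' = Suc r then (False, 1) else always" None "E q1 (Suc r')"])
                (auto simp: IDec apply_op_def holds_def)
            then show False using S' by simp
          qed
          then show ?thesis using S' target by blast
        qed
        have "s r \<noteq> 0" using d1 d2 prems(8)[of r] prems(10)[of r] by auto
        then obtain n where n: "s r = Suc n" using not0_implies_Suc by blast
        have s1: "(s(r := n)) r' = card (S1 (insset r') - S1 (delset r'))" for r'
        proof -
          have "S (insset r) - insert d (S (delset r)) = (S (insset r) - S (delset r)) - {d}" by blast
          then show ?thesis using n d1 d2 prems(8,10) by (auto simp: S1_def)
        qed
        have sub: "S1 (delset r') \<subseteq> S1 (insset r')" for r'
          using d1 prems(9)[of r'] by (auto simp: S1_def)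
        have "\<exists>t. (mstep R)\<^sup>*\<^sup>* (q1, s(r := n)) (h, t)"
          using prems(6-8) by (intro Cons.IH[OF w0 w target(1) nacc guess _ _ _ sub s1]) (auto simp: S1_def)
        moreover have "mstep R (q, s) (q1, s(r := n))"
          using i IDec n by (blast intro: mstep_dec)
        ultimately show ?thesis by (meson converse_rtranclp_into_rtranclp)
      next
        case False
        then have a2: "a = 2" using a a0 by blast
        have nacc: "\<not> acc M w (E q2 0, S)"
        proof
          assume "acc M w (E q2 0, S)"
          then have "acc M (x # w) (E q 0, S)"
            using a2 prems(6) unfolding x
            by (intro tr[of _ _ always None "E q2 0"]) (auto simp: IDec apply_op_def)
          then show False using prems(4) by simp
        qed
        \<comment> \<open>A guess for the tested register would move to the accepting sink; hence no
          datum of \<open>r\<close> is left and the zero test is legitimate.\<close>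
        have guess: "r' \<noteq> r \<and> Suc r' \<in> set (ms q2) \<and> (\<exists>S'. S' 0 = {} \<and> S' 1 = {e} \<and> \<not> acc M w (E q2 (Suc r'), S'))"
          if e: "e \<in> S (insset r')" "e \<notin> S (delset r')" for r' e
        proof -
          obtain S' where S': "Suc r' \<in> set (ms q)" "S' 0 = {}" "S' 1 = {e}"
            "\<not> acc M (x # w) (E q (Suc r'), S')"
            using prems(5)[of e r'] e by auto
          have *: "\<not> acc M w (if Suc r' = Suc r then 1 else E q2 (Suc r'), S')"
          proof
            assume "acc M w (if Suc r' = Suc r then 1 else E q2 (Suc r'), S')"
            then have "acc M (x # w) (E q (Suc r'), S')"
              using a2 S' unfolding x
              by (intro tr[of _ _ always None "if Suc r' = Suc r then 1 else E q2 (Suc r')"])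
                (auto simp: IDec apply_op_def)
            then show False using S' by simp
          qed
          then have "r' \<noteq> r" using sink[of S'] S' by auto
          then show ?thesis using * S' target by auto
        qed
        have "s r = 0"
          using guess[of _ r] prems(10)[of r] by (metis DiffE card.empty equals0I)
        then have "mstep R (q, s) (q2, s)"
          using i IDec by (blast intro: mstep_zero)
        moreover have "\<exists>t. (mstep R)\<^sup>*\<^sup>* (q2, s) (h, t)"
          using guess prems(6-10) by (intro Cons.IH[OF w0 w target(3) nacc]) auto
        ultimately show ?thesis by (meson converse_rtranclp_into_rtranclp)
      qed
    qed
  qed
qed

section \<open>Halting runs yield rejected words\<close>

lemma delta_sourceD:
  assumes "(E q m, a, \<alpha>, op, t) \<in> set (delta M)" "(q, i) \<in> set R" "m \<in> insert 0 (set (ms q))"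
  shows "(E q m, a, \<alpha>, op, t) \<in> set (instr_trans E (ms q) (q, i))"
proof -
  have q: "q \<in> fst ` set R \<union> {h, Suc h}" "q \<noteq> h" "q \<noteq> Suc h" using assms(2) halt by force+
  have "(E q m, a, \<alpha>, op, t) \<notin> set (final_trans E h)"
    using inj[of q m h 0] inj[of q m "Suc h" 0] special[of q m] q assms(3)
    by (auto simp: final_trans_def)
  then obtain q' i' where i': "(q', i') \<in> set R" "(E q m, a, \<alpha>, op, t) \<in> set (instr_trans E (ms q') (q', i'))"
    using assms(1) unfolding delta by blast
  then obtain m' where "E q m = E q' m'" "m' \<in> insert 0 (set (ms q'))"
    by (cases i') auto
  moreover have "q' \<in> fst ` set R \<union> {h, Suc h}" using i' by force
  \<comment> \<open>A state number determines its label and mode, and a label its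
    instruction.\<close>
  ultimately have "q = q'" using inj[of q m q' m'] q(1) assms(3) by blast
  with i' assms(2) distinct have "i = i'" by (metis eq_key_imp_eq_value)
  with i' \<open>q = q'\<close> show ?thesis by simp
qed

lemma delta_halt_sourceD:
  assumes "(E h m, a, \<alpha>, op, t) \<in> set (delta M)" "m \<in> insert 0 (set (ms h))"
  shows "m = 0 \<and> (a = 0 \<longrightarrow> t = E (Suc h) 0)"
proof -
  have "(E h m, a, \<alpha>, op, t) \<notin> set (instr_trans E (ms q') (q', i))" if "(q', i) \<in> set R" for q' i
  proof
    assume "(E h m, a, \<alpha>, op, t) \<in> set (instr_trans E (ms q') (q', i))"
    then obtain m' where "E h m = E q' m'" "m' \<in> insert 0 (set (ms q'))"
      by (cases i) auto
    moreover have "q' \<in> fst ` set R" using that by force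
    ultimately show False using inj[of h m q' m'] assms(2) halt by blast
  qed
  then have "(E h m, a, \<alpha>, op, t) \<in> set (final_trans E h)" using assms(1) unfolding delta by blast
  then show ?thesis
    using inj[of h m h 0] inj[of h m "Suc h" 0] special[of h m] assms(2)
    by (auto simp: final_trans_def)
qed

lemma delta_no_source_2: "(2, a, \<alpha>, op, t) \<notin> set (delta M)"
proof
  assume *: "(2, a, \<alpha>, op, t) \<in> set (delta M)"
  have "(2, a, \<alpha>, op, t) \<notin> set (final_trans E h)"
    using special[of h 0] special[of "Suc h" 0] by (auto simp: final_trans_def)
  then obtain q i where i: "(q, i) \<in> set R" "(2, a, \<alpha>, op, t) \<in> set (instr_trans E (ms q) (q, i))"
    using * unfolding delta by blast
  then obtain m where "2 = E q m" "m \<in> insert 0 (set (ms q))"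
    by (cases i) auto
  moreover have "q \<in> fst ` set R" using i by force
  ultimately show False using special[of q m] by auto
qed

lemma not_acc_2: "w \<noteq> [] \<Longrightarrow> \<not> acc M w (2, S)"
  by (cases w) (auto simp: acc_Cons step_def delta_no_source_2)

lemma not_acc_ConsI:
  assumes "\<And>\<alpha> op t. (p, a, \<alpha>, op, t) \<in> set (delta M) \<Longrightarrow> holds \<alpha> S d \<Longrightarrow>
    \<not> acc M w (t, apply_op op S d)"
  shows "\<not> acc M ((a, d) # w) (p, S)"
  using assms unfolding acc_Cons step_def by (metis fst_conv prod.collapse snd_conv)

text \<open>The word is built along the run: a datum new to the register for an increment, any datum
  still present for a decrement. Guess modes have to reject only for data still present, since
  removal of the guessed datum blocks the branch.\<close>

lemma halts_imp_rejected:
  assumes "(mstep R)\<^sup>*\<^sup>* (q, s) (h, t)"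
    and "\<And>r. finite (A r)" "\<And>r. B r \<subseteq> A r" "\<And>r. s r = card (A r - B r)"
  shows "\<exists>w. w \<noteq> [] \<and> (\<forall>x\<in>set w. fst x < 3) \<and>
    (\<forall>S. S 0 = {} \<longrightarrow> S 1 = {} \<longrightarrow> (\<forall>r. S (insset r) = A r \<and> S (delset r) = B r) \<longrightarrow> \<not> acc M w (E q 0, S)) \<and>
    (\<forall>S r d. S 0 = {} \<longrightarrow> S 1 = {d} \<longrightarrow> d \<in> A r - B r \<longrightarrow> Suc r \<in> set (ms q) \<longrightarrow> \<not> acc M w (E q (Suc r), S))"
  using assms
proof (induction "(q, s)" arbitrary: q s A B rule: converse_rtranclp_induct)
  case base
  show ?case
  proof (intro exI[of _ "[(0, 0)]"] conjI allI impI)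
    have "E (Suc h) 0 \<noteq> E start 0" using inj[of "Suc h" 0 start 0] start halt by auto
    then have *: "E (Suc h) 0 \<notin> set (finals M)" using special[of "Suc h" 0] by (auto simp: finals)
    show "\<not> acc M [(0, 0)] (E h 0, S)" for S
      using * by (intro not_acc_ConsI) (auto dest!: delta_halt_sourceD)
    show "\<not> acc M [(0, 0)] (E h (Suc r), S)" if "Suc r \<in> set (ms h)" for S r
      using that by (intro not_acc_ConsI) (auto dest!: delta_halt_sourceD)
  qed auto
next
  case (step c)
  have q: "q \<in> fst ` set R \<union> {h, Suc h}" using mstep_source[OF step.hyps(1)] by simp
  have injs: "E q m = E q m' \<longleftrightarrow> m = m'" if "m \<in> set (ms q)" "m' \<in> set (ms q)" for m m'
    using inj[of q m q m'] q that by blast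
  have injs0: "E q m \<noteq> E q 0" "E q 0 \<noteq> E q m" if "m \<in> set (ms q)" for m
    using inj[of q m q 0] q that modes[of q] by auto
  from step.hyps(1) show ?case
  proof cases
    case (mstep_inc r q')
    obtain d where d: "d \<notin> A r" using step.prems(1)[of r] ex_new_if_finite infinite_UNIV_nat by blast
    have target: "set (ms q) \<subseteq> set (ms q')" "Suc r \<in> set (ms q')" using target_inc mstep_inc by auto
    define A' where "A' = A(r := insert d (A r))"
    have "d \<notin> B r" using d step.prems(2)[of r] by blast
    then have ins: "insert d (A r) - B r = insert d (A r - B r)" by blast
    have crd: "(s(r := Suc (s r))) r' = card (A' r' - B r')" for r'
      using ins d step.prems by (auto simp: A'_def)
    have fin: "finite (A' r')" and sub: "B r' \<subseteq> A' r'" for r'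
      using step.prems(1)[of r'] step.prems(2)[of r'] by (auto simp: A'_def)
    obtain w where w: "w \<noteq> []" "\<forall>x\<in>set w. fst x < 3"
      "\<forall>S. S 0 = {} \<longrightarrow> S 1 = {} \<longrightarrow> (\<forall>r. S (insset r) = A' r \<and> S (delset r) = B r) \<longrightarrow> \<not> acc M w (E q' 0, S)"
      "\<forall>S r d. S 0 = {} \<longrightarrow> S 1 = {d} \<longrightarrow> d \<in> A' r - B r \<longrightarrow> Suc r \<in> set (ms q') \<longrightarrow> \<not> acc M w (E q' (Suc r), S)"
      using step.hyps(3)[OF mstep_inc(1) fin sub crd] by (elim exE conjE) (rule that)
    note w = w(1,2) w(3,4)[rule_format]
    show ?thesis
    proof (intro exI[of _ "(0, d) # w"] conjI allI impI)
      fix S :: "nat \<Rightarrow> nat set" assume S: "S 0 = {}" "S 1 = {}" "\<forall>r. S (insset r) = A r \<and> S (delset r) = B r"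
      show "\<not> acc M ((0, d) # w) (E q 0, S)"
      proof (rule not_acc_ConsI)
        fix \<alpha> op t assume t: "(E q 0, 0, \<alpha>, op, t) \<in> set (delta M)" "holds \<alpha> S d"
        from delta_sourceD[OF t(1) mstep_inc(2)] consider
          "op = Some (insset r)" "t = E q' 0" | "\<alpha> = (True, insset r)" 
          | "op = Some 1" "t = E q' (Suc r)" | "t = 2"
          using injs0 by force
        then show "\<not> acc M w (t, apply_op op S d)"
        proof cases
          case 1
          then show ?thesis using S w(3) by (auto simp: apply_op_def A'_def)
        next
          case 2
          then show ?thesis using t(2) S d by (auto simp: holds_def)
        next
          case 3
          then show ?thesis using S w(4)[of "S(1 := {d})" d r] target \<open>d \<notin> B r\<close>
            by (auto simp: apply_op_def A'_def)
        next
          case 4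
          then show ?thesis using not_acc_2 w(1) by blast
        qed
      qed
    next
      fix S :: "nat \<Rightarrow> nat set" and r' e
      assume S: "S 0 = {}" "S 1 = {e}" "e \<in> A r' - B r'" "Suc r' \<in> set (ms q)"
      show "\<not> acc M ((0, d) # w) (E q (Suc r'), S)"
      proof (rule not_acc_ConsI)
        fix \<alpha> op t assume t: "(E q (Suc r'), 0, \<alpha>, op, t) \<in> set (delta M)" "holds \<alpha> S d"
        have "(E q (Suc r'), 0, \<alpha>, op, t) \<in> set (instr_trans E (ms q) (q, IInc r q'))"
          using delta_sourceD[OF t(1) mstep_inc(2)] S(4) by simp
        then have "op = None \<and> t = E q' (Suc r')"
          using injs0[OF S(4)] by (auto dest: injs[OF S(4), THEN iffD1])
        moreover have "e \<in> A' r' - B r'" using S by (auto simp: A'_def)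
        ultimately show "\<not> acc M w (t, apply_op op S d)"
          using w(4)[of S e r'] S target by (auto simp: apply_op_def)
      qed
    qed (use w in auto)
  next
    case (mstep_dec r q1 q2 n)
    have target: "set (ms q) \<subseteq> set (ms q1)" using target_dec mstep_dec by blast
    have "A r - B r \<noteq> {}" using step.prems(3)[of r] mstep_dec(3) by force
    then obtain d where d: "d \<in> A r" "d \<notin> B r" by blast
    define B' where "B' = B(r := insert d (B r))"
    have del: "A r - insert d (B r) = (A r - B r) - {d}" by blast
    have "card ((A r - B r) - {d}) = n"
      using step.prems(1)[of r] step.prems(3)[of r] mstep_dec d by simp
    then have crd: "(s(r := n)) r' = card (A r' - B' r')" for r'
      using del d step.prems by (auto simp: B'_def)
    have sub: "B' r' \<subseteq> A r'" for r'
      using d step.prems(2)[of r'] by (auto simp: B'_def)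
    obtain w where w: "w \<noteq> []" "\<forall>x\<in>set w. fst x < 3"
      "\<forall>S. S 0 = {} \<longrightarrow> S 1 = {} \<longrightarrow> (\<forall>r. S (insset r) = A r \<and> S (delset r) = B' r) \<longrightarrow> \<not> acc M w (E q1 0, S)"
      "\<forall>S r d. S 0 = {} \<longrightarrow> S 1 = {d} \<longrightarrow> d \<in> A r - B' r \<longrightarrow> Suc r \<in> set (ms q1) \<longrightarrow> \<not> acc M w (E q1 (Suc r), S)"
      using step.hyps(3)[OF mstep_dec(1) step.prems(1) sub crd] by (elim exE conjE) (rule that)
    note w = w(1,2) w(3,4)[rule_format]
    show ?thesis
    proof (intro exI[of _ "(1, d) # w"] conjI allI impI)
      fix S :: "nat \<Rightarrow> nat set" assume S: "S 0 = {}" "S 1 = {}" "\<forall>r. S (insset r) = A r \<and> S (delset r) = B r"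
      show "\<not> acc M ((1, d) # w) (E q 0, S)"
      proof (rule not_acc_ConsI)
        fix \<alpha> op t assume t: "(E q 0, 1, \<alpha>, op, t) \<in> set (delta M)" "holds \<alpha> S d"
        from delta_sourceD[OF t(1) mstep_dec(2)] consider
          "op = Some (delset r)" "t = E q1 0" | "\<alpha> = (False, insset r)" | "\<alpha> = (True, delset r)" | "t = 2"
          using injs0 by force
        then show "\<not> acc M w (t, apply_op op S d)"
        proof cases
          case 1
          then show ?thesis using S w(3) by (auto simp: apply_op_def B'_def)
        next
          case 4
          then show ?thesis using not_acc_2 w(1) by blast
        qed (use t(2) S d in \<open>auto simp: holds_def\<close>)
      qed
    next
      fix S :: "nat \<Rightarrow> nat set" and r' e
      assume S: "S 0 = {}" "S 1 = {e}" "e \<in> A r' - B r'" "Suc r' \<in> set (ms q)"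
      show "\<not> acc M ((1, d) # w) (E q (Suc r'), S)"
      proof (rule not_acc_ConsI)
        fix \<alpha> op t assume t: "(E q (Suc r'), 1, \<alpha>, op, t) \<in> set (delta M)" "holds \<alpha> S d"
        have "(E q (Suc r'), 1, \<alpha>, op, t) \<in> set (instr_trans E (ms q) (q, IDec r q1 q2))"
          using delta_sourceD[OF t(1) mstep_dec(2)] S(4) by simp
        then have *: "op = None \<and> t = E q1 (Suc r') \<and> (r' = r \<longrightarrow> \<alpha> = (False, 1))"
          using injs0[OF S(4)] by (auto dest: injs[OF S(4), THEN iffD1])
        \<comment> \<open>The test against set 1 shows that the removed datum is not the guessed
          one, which therefore stays present.\<close>
        then have "e \<in> A r' - B' r'" using S t(2) by (auto simp: B'_def holds_def)
        then show "\<not> acc M w (t, apply_op op S d)"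
          using w(4)[of S e r'] S target * by (auto simp: apply_op_def)
      qed
    qed (use w in auto)
  next
    case (mstep_zero r q1 q2)
    have target: "set (ms q) \<subseteq> set (ms q2)" using target_dec mstep_zero by blast
    have zero: "A r - B r = {}" using step.prems(1)[of r] step.prems(3)[of r] mstep_zero by auto
    obtain w where w: "w \<noteq> []" "\<forall>x\<in>set w. fst x < 3"
      "\<forall>S. S 0 = {} \<longrightarrow> S 1 = {} \<longrightarrow> (\<forall>r. S (insset r) = A r \<and> S (delset r) = B r) \<longrightarrow> \<not> acc M w (E q2 0, S)"
      "\<forall>S r d. S 0 = {} \<longrightarrow> S 1 = {d} \<longrightarrow> d \<in> A r - B r \<longrightarrow> Suc r \<in> set (ms q2) \<longrightarrow> \<not> acc M w (E q2 (Suc r), S)"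
      using step.hyps(3)[OF mstep_zero(1) step.prems] by (elim exE conjE) (rule that)
    note w = w(1,2) w(3,4)[rule_format]
    show ?thesis
    \<comment> \<open>The transitions for zero tests ignore the datum, so 0 is an arbitrary
      choice.\<close>
    proof (intro exI[of _ "(2, 0) # w"] conjI allI impI)
      fix S :: "nat \<Rightarrow> nat set" assume S: "S 0 = {}" "S 1 = {}" "\<forall>r. S (insset r) = A r \<and> S (delset r) = B r"
      show "\<not> acc M ((2, 0) # w) (E q 0, S)"
      proof (rule not_acc_ConsI)
        fix \<alpha> op t assume t: "(E q 0, 2, \<alpha>, op, t) \<in> set (delta M)" "holds \<alpha> S 0"
        from delta_sourceD[OF t(1) mstep_zero(2)] have "op = None \<and> t = E q2 0 \<or> t = 2"
          using injs0 by force
        then show "\<not> acc M w (t, apply_op op S 0)"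
          using S w(3)[of S] not_acc_2[of w] w(1) by (auto simp: apply_op_def)
      qed
    next
      fix S :: "nat \<Rightarrow> nat set" and r' e
      assume S: "S 0 = {}" "S 1 = {e}" "e \<in> A r' - B r'" "Suc r' \<in> set (ms q)"
      show "\<not> acc M ((2, 0) # w) (E q (Suc r'), S)"
      proof (rule not_acc_ConsI)
        fix \<alpha> op t assume t: "(E q (Suc r'), 2, \<alpha>, op, t) \<in> set (delta M)" "holds \<alpha> S 0"
        have "r' \<noteq> r" using S(3) zero by blast
        have "(E q (Suc r'), 2, \<alpha>, op, t) \<in> set (instr_trans E (ms q) (q, IDec r q1 q2))"
          using delta_sourceD[OF t(1) mstep_zero(2)] S(4) by simp
        then have "op = None \<and> t = E q2 (Suc r')"
          using injs0[OF S(4)] \<open>r' \<noteq> r\<close> by (auto dest: injs[OF S(4), THEN iffD1])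
        then show "\<not> acc M w (t, apply_op op S 0)"
          using w(4)[of S e r'] S target by (auto simp: apply_op_def)
      qed
    qed (use w in auto)
  qed
qed

theorem universal_iff_not_halts:
  assumes "wf_safa M" "n_syms M = 3"
  shows "universal M \<longleftrightarrow> \<not> mhalts R start h"
proof -
  have acc: "accepts M w \<longleftrightarrow> acc M w (E start 0, \<lambda>_. {})" for w
    by (simp add: accepts_def acc_def init)
  have "universal M \<longleftrightarrow> (\<forall>w. (\<forall>x\<in>set w. fst x < 3) \<longrightarrow> acc M w (E start 0, \<lambda>_. {}))"
  proof -
    have "lists ({0..<3} \<times> UNIV) = {w :: (nat \<times> nat) list. \<forall>x\<in>set w. fst x < 3}"
      by (auto simp: lists_eq_set)
    then have "universal M \<longleftrightarrow> (\<forall>w. acc M w (E start 0, \<lambda>_. {}) = (\<forall>x\<in>set w. fst x < 3))"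
      using assms(2) by (simp only: universal_def lang_def acc set_eq_iff mem_Collect_eq)
    moreover have "acc M w (E start 0, \<lambda>_. {}) \<Longrightarrow> \<forall>x\<in>set w. fst x < 3" for w
      using acc_letters[OF assms(1)] assms(2) by simp
    ultimately show ?thesis by iprover
  qed
  moreover have "mhalts R start h" if "\<forall>x\<in>set w. fst x < 3" "\<not> acc M w (E start 0, \<lambda>_. {})" for w
  proof -
    have "w \<noteq> []" using that(2) by (auto simp: finals)
    then show ?thesis
      unfolding mhalts_def using that start
      by (intro rejected_imp_halts[where w = w and S = "\<lambda>_. {}"]) auto
  qed
  moreover have "\<exists>w. (\<forall>x\<in>set w. fst x < 3) \<and> \<not> acc M w (E start 0, \<lambda>_. {})" if "mhalts R start h"
  proof -
    from that obtain t where run: "(mstep R)\<^sup>*\<^sup>* (start, \<lambda>_. 0) (h, t)" by (auto simp: mhalts_def)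
    have "finite {}" "{} \<subseteq> {}" "0 = card ({} - {})" by simp_all
    from halts_imp_rejected[where A = "\<lambda>_. {}" and B = "\<lambda>_. {}", OF run this]
    obtain w where w: "\<forall>x\<in>set w. fst x < 3"
      "\<forall>S. S 0 = {} \<longrightarrow> S 1 = {} \<longrightarrow> (\<forall>r. S (insset r) = {} \<and> S (delset r) = {}) \<longrightarrow>
        \<not> acc M w (E start 0, S)"
      by (elim exE conjE) (rule that)
    have "\<not> acc M w (E start 0, \<lambda>_. {})" by (rule w(2)[rule_format]) simp_all
    with w(1) show ?thesis by blast
  qed
  ultimately show ?thesis by blast
qed

end

section \<open>Computable functions\<close>

text \<open>Total functions of a fixed arity \<open>k\<close>. Sums, products, pairing and primitive
  recursion will be enough, since codes are only built and never taken apart.\<close>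

definition computable :: "nat \<Rightarrow> (nat list \<Rightarrow> nat) \<Rightarrow> bool" where
  "computable k F \<longleftrightarrow> (\<exists>r. \<forall>xs. length xs = k \<longrightarrow> eval r xs (F xs))"

lemma computable_proj: "i < k \<Longrightarrow> computable k (\<lambda>xs. xs ! i)"
  unfolding computable_def using eval_Proj by blast

lemma computable_unaryE:
  assumes "computable 1 (\<lambda>xs. f (xs ! 0))"
  obtains r where "\<And>x. eval r [x] (f x)"
proof -
  obtain r where r: "\<And>xs. length xs = 1 \<Longrightarrow> eval r xs (f (xs ! 0))"
    using assms unfolding computable_def by blast
  show thesis using that[of r] r[of "[_]"] by simp
qed

lemma computable_Suc:
  assumes "computable k F"
  shows "computable k (\<lambda>xs. Suc (F xs))"
proof -
  obtain r where r: "\<forall>xs. length xs = k \<longrightarrow> eval r xs (F xs)" using assms by (auto simp: computable_def)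
  have "eval (Comp Succ [r]) xs (Suc (F xs))" if "length xs = k" for xs
    using r that by (intro eval_Comp[where ys = "[F xs]"]) (auto intro: eval_Succ)
  then show ?thesis by (auto simp: computable_def)
qed

lemma computable_const: "computable k (\<lambda>_. c)"
proof (induction c)
  case 0
  then show ?case unfolding computable_def using eval_Zero by blast
next
  case (Suc c)
  then show ?case by (rule computable_Suc)
qed

lemma computable_compose2:
  assumes "computable 2 (\<lambda>xs. f (xs ! 0) (xs ! 1))" "computable k F" "computable k G"
  shows "computable k (\<lambda>xs. f (F xs) (G xs))"
proof -
  obtain r r1 r2 where r: "\<forall>xs. length xs = 2 \<longrightarrow> eval r xs (f (xs ! 0) (xs ! 1))"
    "\<forall>xs. length xs = k \<longrightarrow> eval r1 xs (F xs)" "\<forall>xs. length xs = k \<longrightarrow> eval r2 xs (G xs)"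
    using assms unfolding computable_def by blast
  have "eval (Comp r [r1, r2]) xs (f (F xs) (G xs))" if "length xs = k" for xs
    using r(2,3) that r(1)[rule_format, of "[F xs, G xs]"]
    by (intro eval_Comp[where ys = "[F xs, G xs]"]) auto
  then show ?thesis by (auto simp: computable_def)
qed

lemma computable_prim:
  assumes "computable k G" "computable (Suc (Suc k)) H"
    and "\<And>n xs. length xs = k \<Longrightarrow> F (n # xs) = rec_nat (G xs) (\<lambda>i y. H (i # y # xs)) n"
  shows "computable (Suc k) F"
proof -
  obtain g h where g: "\<And>xs. length xs = k \<Longrightarrow> eval g xs (G xs)"
    and h: "\<And>xs. length xs = Suc (Suc k) \<Longrightarrow> eval h xs (H xs)"
    using assms(1,2) by (auto simp: computable_def)
  have "eval (Prim g h) (n # xs) (rec_nat (G xs) (\<lambda>i y. H (i # y # xs)) n)" if "length xs = k" for n xs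
  proof (induction n)
    case 0
    then show ?case using g[OF that] by (auto intro: eval_Prim0)
  next
    case (Suc n)
    then show ?case using h that by (auto intro!: eval_PrimS)
  qed
  then have "eval (Prim g h) xs (F xs)" if "length xs = Suc k" for xs
    using that assms(3) by (auto simp: length_Suc_conv)
  then show ?thesis unfolding computable_def by blast
qed

lemma computable_add:
  assumes "computable k F" "computable k G"
  shows "computable k (\<lambda>xs. F xs + G xs)"
proof (rule computable_compose2[OF _ assms])
  have "rec_nat b (\<lambda>i y. Suc y) a = a + b" for a b :: nat by (induction a) auto
  then have "computable (Suc 1) (\<lambda>xs. xs ! 0 + xs ! 1)"
    by (intro computable_prim[of 1 "\<lambda>xs. xs ! 0" "\<lambda>xs. Suc (xs ! 1)"] computable_proj computable_Suc) auto
  then show "computable 2 (\<lambda>xs. xs ! 0 + xs ! 1)" by (simp add: numeral_2_eq_2)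
qed

lemma computable_mult:
  assumes "computable k F" "computable k G"
  shows "computable k (\<lambda>xs. F xs * G xs)"
proof (rule computable_compose2[OF _ assms])
  have "rec_nat 0 (\<lambda>i y. y + b) a = a * b" for a b :: nat by (induction a) auto
  then have "computable (Suc 1) (\<lambda>xs. xs ! 0 * xs ! 1)"
    by (intro computable_prim[of 1 "\<lambda>_. 0" "\<lambda>xs. xs ! 1 + xs ! 2"]
        computable_proj computable_add computable_const) auto
  then show "computable 2 (\<lambda>xs. xs ! 0 * xs ! 1)" by (simp add: numeral_2_eq_2)
qed

text \<open>\<open>prod_encode (m, n)\<close> is \<open>triangle (m + n) + m\<close>, and triangular
  numbers arise by primitive recursion.\<close>

lemma computable_prod_encode:
  assumes "computable k F" "computable k G"
  shows "computable k (\<lambda>xs. prod_encode (F xs, G xs))"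
proof -
  have "rec_nat 0 (\<lambda>i y. y + Suc i) a = triangle a" for a :: nat by (induction a) auto
  then have "computable (Suc 0) (\<lambda>xs. triangle (xs ! 0))"
    by (intro computable_prim[of 0 "\<lambda>_. 0" "\<lambda>xs. xs ! 1 + Suc (xs ! 0)"]
        computable_proj computable_add computable_const computable_Suc) auto
  then obtain r where r: "\<forall>xs. length xs = 1 \<longrightarrow> eval r xs (triangle (xs ! 0))"
    by (auto simp: computable_def)
  obtain s where s: "\<forall>xs. length xs = k \<longrightarrow> eval s xs (F xs + G xs)"
    using computable_add[OF assms] by (auto simp: computable_def)
  have "eval (Comp r [s]) xs (triangle (F xs + G xs))" if "length xs = k" for xs
    using s that r[rule_format, of "[F xs + G xs]"]
    by (intro eval_Comp[where ys = "[F xs + G xs]"]) auto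
  then have "computable k (\<lambda>xs. triangle (F xs + G xs))" by (auto simp: computable_def)
  from computable_add[OF this assms(1)] show ?thesis by (simp add: prod_encode_def)
qed

lemmas computable_intros =
  computable_const computable_proj computable_Suc computable_add computable_mult computable_prod_encode

section \<open>The reduction\<close>

text \<open>These transitions simulate \<open>p\<close> initial increments of register 0, before the ones of a given
  program take over in state 0. When \<open>j\<close> increments remain, the state is \<open>j * p\<close>, or \<open>j * p + 3\<close>
  if a datum has been guessed. Later \<open>p\<close> is the code of the transitions of the program itself; as it
  exceeds all their states, the multiples of \<open>p\<close> are fresh.\<close>

definition load_trans :: "nat \<Rightarrow> nat \<Rightarrow> trans list" where
  "load_trans p j =
    [(Suc j * p, 0, always, Some 2, j * p),
     (Suc j * p, 0, (True, 2), None, 1),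
     (Suc j * p, 1, always, None, 1),
     (Suc j * p, 2, always, None, 1),
     (Suc j * p, 0, always, Some 1, j * p + 3),
     (Suc j * p, 0, always, None, 2),
     (Suc j * p + 3, 0, always, None, j * p + 3)]"

text \<open>Everything apart from \<open>D\<close> depends on \<open>p\<close> alone. For large
  \<open>p\<close> the greatest state is \<open>p * p + 3\<close>, the guess mode of the start
  state. The reversed order puts the transitions of step \<open>j\<close> in front of those of
  smaller steps, so that the list grows at its head as \<open>j\<close> increases.\<close>

definition load_safa :: "nat \<Rightarrow> trans list \<Rightarrow> safa" where
  "load_safa p D = \<lparr>n_states = p * p + p, n_syms = 3, n_sets = p, init = p * p, finals = [p * p, 1, 2],
     delta = concat (map (load_trans p) (rev [0..<p])) @ D\<rparr>"

text \<open>The recursion starts from \<open>p\<close>, which already is the code of the tail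
  \<open>D\<close>, and prepends the loading transitions, so \<open>D\<close> never has to be
  recovered from \<open>p\<close>.\<close>

definition load_code :: "nat \<Rightarrow> nat" where
  "load_code p = list_encode [p * p + p, 3, p, p * p, list_encode [p * p, 1, 2],
     rec_nat p (\<lambda>j y. foldr (\<lambda>t y. Suc (prod_encode (encode_trans t, y))) (load_trans p j) y) p]"

lemma list_encode_append:
  "list_encode (map f xs @ ys) = foldr (\<lambda>x y. Suc (prod_encode (f x, y))) xs (list_encode ys)"
  by (induction xs) auto

lemma encode_load_safa:
  assumes "p = list_encode (map encode_trans D)"
  shows "encode_safa (load_safa p D) = load_code p"
proof -
  have "list_encode (map encode_trans (concat (map (load_trans p) (rev [0..<n])) @ D)) =
    rec_nat p (\<lambda>j y. foldr (\<lambda>t y. Suc (prod_encode (encode_trans t, y))) (load_trans p j) y) n" for n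
    by (induction n) (simp_all add: assms[symmetric] list_encode_append)
  then show ?thesis by (simp add: encode_safa_def load_safa_def load_code_def)
qed

lemma computable_load_code: "computable 1 (\<lambda>xs. load_code (xs ! 0))"
proof -
  let ?step = "\<lambda>p j y. foldr (\<lambda>t y. Suc (prod_encode (encode_trans t, y))) (load_trans p j) y"
  have "computable 3 (\<lambda>xs. ?step (xs ! 2) (xs ! 0) (xs ! 1))"
    by (simp add: load_trans_def encode_trans_def) (intro computable_intros; simp)
  \<comment> \<open>Recursion bound and parameter are kept apart here; both are set to
    \<open>p\<close> afterwards.\<close>
  then have "computable (Suc 1) (\<lambda>xs. rec_nat (xs ! 1) (?step (xs ! 1)) (xs ! 0))"
    by (intro computable_prim[of 1 "\<lambda>xs. xs ! 0" "\<lambda>xs. ?step (xs ! 2) (xs ! 0) (xs ! 1)"] computable_proj)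
      (simp_all add: numeral_3_eq_3)
  then have "computable 2 (\<lambda>xs. rec_nat (xs ! 1) (?step (xs ! 1)) (xs ! 0))" by (simp add: numeral_2_eq_2)
  from computable_compose2[OF this computable_proj computable_proj, of 0 1 0]
  have "computable 1 (\<lambda>xs. rec_nat (xs ! 0) (?step (xs ! 0)) (xs ! 0))" by simp
  then show ?thesis
    unfolding load_code_def list_encode.simps by (intro computable_intros; simp)
qed

section \<open>Injectivity and size of codes\<close>

lemma inj_encode_trans: "inj encode_trans"
proof (rule injI)
  fix s t assume "encode_trans s = encode_trans t"
  then show "s = t"
    by (cases s; cases t) (auto simp: encode_trans_def list_encode_eq split: if_splits option.splits)
qed

lemma inj_encode_safa: "encode_safa M = encode_safa N \<Longrightarrow> M = N"
  by (cases M; cases N)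
    (auto simp: encode_safa_def list_encode_eq inj_map_eq_map[OF inj_encode_trans]
      simp del: list_encode.simps)

text \<open>Through this bound, repeated entries make a code as large as desired.\<close>

lemma length_le_list_encode: "length xs \<le> list_encode xs"
proof (induction xs)
  case (Cons x xs)
  then show ?case using le_prod_encode_2[of "list_encode xs" x] by simp
qed simp

fun instr_reg :: "instr \<Rightarrow> nat" where
  "instr_reg (IInc r q) = r"
| "instr_reg (IDec r q1 q2) = r"

text \<open>The fixed point: \<open>D\<close> contains the transitions of \<open>c\<close> itself,
  and \<open>c\<close> runs on the code \<open>p\<close> of \<open>D\<close>. A guard loop appended
  to \<open>c\<close> turns the content of register 1 into halting or divergence.\<close>

lemma program_safa_exists:
  "\<exists>p D. p = list_encode (map encode_trans D) \<and> wf_safa (load_safa p D) \<and>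
     (\<forall>t. bigstep c ((\<lambda>_. 0)(0 := p)) t \<longrightarrow> (universal (load_safa p D) \<longleftrightarrow> t 1 \<noteq> 0))"
proof -
  define g where "g = Seq c (While 1 (Inc 1))"
  define h where "h = code_size g"
  define P where "P = compile g 0 h"
  \<comment> \<open>The factor 3 keeps the states away from 1 and 2. Since
    \<open>prod_encode (0, 1) = 1\<close>, label 0 has the states 0 and 3 in modes 0 and 1, exactly
    the targets \<open>j * p\<close> and \<open>j * p + 3\<close> of the last loading step, where
    \<open>j = 0\<close>.\<close>
  define E0 where "E0 q m = 3 * prod_encode (q, m)" for q m :: nat
  have h0: "0 < h" unfolding h_def by (rule code_size_pos)
  have labels: "map fst P = [0..<h]" by (simp add: P_def labels_compile h_def)
  then have labels': "fst ` set P = {..<h}" by (metis atLeast_upt list.set_map set_upt)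
  obtain k0 where k0: "\<forall>r\<in>instr_reg ` snd ` set P. r < k0"
    by (meson finite_imageI finite_nat_set_iff_bounded List.finite_set)
  \<comment> \<open>With \<open>k\<close> positive, mode 1, a guess for register 0, is among the
    modes of the program; loading hands over such guesses.\<close>
  define k where "k = Suc k0"
  have k: "instr_reg i < k" if "(q, i) \<in> set P" for q i
    using k0 that unfolding k_def by force
  \<comment> \<open>The element 10 also lifts \<open>p\<close> above the special states, sets 0 and
    1, and the offset 3 of a guess during loading.\<close>
  define X where "X = (\<lambda>(q, m). E0 q m) ` ({..Suc h} \<times> {..k}) \<union> insset ` {..k} \<union> delset ` {..k} \<union> {10}"
  have "finite X" by (simp add: X_def)
  then obtain B where B: "\<forall>x\<in>X. x < B"
    unfolding finite_nat_set_iff_bounded by blast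
  \<comment> \<open>Repeating a harmless transition pushes the code \<open>p\<close> above all states and set names.\<close>
  define D where "D = replicate B (1, 0, always, None, 1) @
    concat (map (instr_trans E0 [1..<Suc k]) P) @ final_trans E0 h"
  define p where "p = list_encode (map encode_trans D)"
  have "B \<le> p" unfolding p_def using length_le_list_encode[of "map encode_trans D"] by (simp add: D_def)
  then have X: "x < p" if "x \<in> X" for x using B that by (meson order.strict_trans2)
  have bound: "\<And>q m. q \<le> Suc h \<Longrightarrow> m \<le> k \<Longrightarrow> E0 q m < p"
    "\<And>r. r \<le> k \<Longrightarrow> insset r < p" "\<And>r. r \<le> k \<Longrightarrow> delset r < p" "10 < p"
    by (auto intro!: X simp: X_def)
  have target_P: "case i of IInc r q' \<Rightarrow> q' \<le> h | IDec r q1 q2 \<Rightarrow> q1 \<le> h \<and> q2 \<le> h"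
    if "(q, i) \<in> set P" for q i
    using compile_targets[OF that[unfolded P_def]] by (cases i) (auto simp: h_def)
  have D_bound: "q < p \<and> a < 3 \<and> i < p \<and> q' < p \<and> (\<forall>j. op = Some j \<longrightarrow> j < p)"
    if t: "(q, a, (b, i), op, q') \<in> set D" for q a b i op q'
  proof -
    from t consider "(q, a, (b, i), op, q') = (1, 0, always, None, 1)"
      | "(q, a, (b, i), op, q') \<in> set (final_trans E0 h)"
      | l ins where "(l, ins) \<in> set P" "(q, a, (b, i), op, q') \<in> set (instr_trans E0 [1..<Suc k] (l, ins))"
      unfolding D_def by auto
    then show ?thesis
    proof cases
      case 1
      then show ?thesis using bound(4) by simp
    next
      case 2
      then show ?thesis using bound(4) bound(1)[of h 0] bound(1)[of "Suc h" 0] by (auto simp: final_trans_def)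
    next
      case 3
      have l: "l < h" using 3(1) labels' by force
      show ?thesis
      proof (cases ins)
        case (IInc r l')
        have "l' \<le> h" "r < k" using target_P[OF 3(1)] k[OF 3(1)] IInc by auto
        then show ?thesis using 3(2) l bound(4) unfolding IInc by (auto intro!: bound(1,2,3))
      next
        case (IDec r l1 l2)
        have "l1 \<le> h" "l2 \<le> h" "r < k" using target_P[OF 3(1)] k[OF 3(1)] IDec by auto
        then show ?thesis using 3(2) l bound(4) unfolding IDec by (auto intro!: bound(1,2,3) split: if_splits)
      qed
    qed
  qed
  \<comment> \<open>The labels \<open>h\<close> and \<open>Suc h\<close> belong to halting and to
    the additional final letter, so loading uses the labels above; with no increments left it enters
    the program at label 0.\<close>
  define lab where "lab j = (if j = 0 then 0 else Suc h + j)" for j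
  define R where "R = map (\<lambda>j. (lab (Suc j), IInc 0 (lab j))) (rev [0..<p]) @ P"
  define E where "E q m = (if q \<le> Suc h then E0 q m else (q - Suc h) * p + 3 * m)" for q m
  define ms where "ms q = (if q \<le> Suc h then [1..<Suc k] else [1])" for q
  have wf: "wf_safa (load_safa p D)"
  proof -
    have *: "j * p + p \<le> p * p" if "j < p" for j
      using mult_le_mono1[of "Suc j" p p] that by simp
    have "q < p * p + p \<and> a < 3 \<and> i < p \<and> q' < p * p + p \<and> (\<forall>j. op = Some j \<longrightarrow> j < p)"
      if "(q, a, (b, i), op, q') \<in> set (load_trans p j)" "j < p" for q a b i op q' j
      using that *[OF that(2)] bound(4) by (auto simp: load_trans_def)
    moreover have "q < p * p + p \<and> a < 3 \<and> i < p \<and> q' < p * p + p \<and> (\<forall>j. op = Some j \<longrightarrow> j < p)"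
      if "(q, a, (b, i), op, q') \<in> set D" for q a b i op q'
      using D_bound[OF that] by auto
    ultimately show ?thesis using bound(4) by (fastforce simp: wf_safa_def load_safa_def)
  qed
  have set_R: "set R = (\<lambda>j. (lab (Suc j), IInc 0 (lab j))) ` {..<p} \<union> set P"
    by (auto simp: R_def)
  have labels_R: "fst ` set R = {Suc h<..Suc h + p} \<union> {..<h}"
  proof -
    have "(\<lambda>j. lab (Suc j)) ` {..<p} = {Suc h<..Suc h + p}"
    proof (intro equalityI subsetI)
      fix x assume "x \<in> {Suc h<..Suc h + p}"
      then show "x \<in> (\<lambda>j. lab (Suc j)) ` {..<p}"
        by (intro image_eqI[of _ _ "x - Suc (Suc h)"]) (auto simp: lab_def)
    qed (auto simp: lab_def)
    then show ?thesis using labels' by (simp add: set_R image_Un image_image)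
  qed
  have E_le: "E q m = E0 q m" and ms_le: "ms q = [1..<Suc k]" if "q \<le> Suc h" for q m
    using that by (simp_all add: E_def ms_def)
  have E_gt: "E q m = (q - Suc h) * p + 3 * m" "ms q = [1]" if "Suc h < q" for q m
    using that by (simp_all add: E_def ms_def)
  have E_lab: "E (lab j) 0 = j * p" "E (lab j) 1 = j * p + 3" for j
    by (auto simp: lab_def E_def E0_def prod_encode_def)
  have small: "E q m < p" if "q \<le> Suc h" "m \<in> insert 0 (set (ms q))" for q m
    using that bound(1)[of q m] by (auto simp: E_le ms_le)
  have large: "p \<le> E q m" if "Suc h < q" for q m
  proof -
    have "1 * p \<le> (q - Suc h) * p" using that by (intro mult_le_mono1) simp
    then show ?thesis unfolding E_gt(1)[OF that] by linarith
  qed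
  interpret machine_safa R E ms "lab p" h "load_safa p D"
  proof
    show "distinct (map fst R)"
    proof -
      have "distinct (map (\<lambda>j. lab (Suc j)) (rev [0..<p]))"
        by (auto simp: distinct_map inj_on_def lab_def)
      then show ?thesis using labels by (auto simp: R_def comp_def lab_def)
    qed
    show "h \<notin> fst ` set R" "Suc h \<notin> fst ` set R" unfolding labels_R by auto
    show "lab p \<in> fst ` set R" using bound(4) unfolding labels_R by (auto simp: lab_def)
    show "0 \<notin> set (ms q)" for q by (auto simp: ms_def)
    show "init (load_safa p D) = E (lab p) 0" by (simp add: load_safa_def E_lab)
    show "set (finals (load_safa p D)) = {E (lab p) 0, 1, 2}" by (simp add: load_safa_def E_lab)
    show "E q m \<noteq> 1 \<and> E q m \<noteq> 2" if "m \<in> insert 0 (set (ms q))" for q m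
    proof (cases "q \<le> Suc h")
      case True
      then show ?thesis unfolding E_le[OF True] E0_def by presburger
    next
      case False
      then show ?thesis using large[of q m] bound(4) by simp
    qed
    show "q = q' \<and> m = m'" if eq: "E q m = E q' m'"
      and m: "m \<in> insert 0 (set (ms q))" "m' \<in> insert 0 (set (ms q'))" for q m q' m'
    proof -
      have same: "q \<le> Suc h \<longleftrightarrow> q' \<le> Suc h"
        using eq small[OF _ m(1)] small[OF _ m(2)] large[of q m] large[of q' m']
        by (metis leD not_le_imp_less)
      show ?thesis
      proof (cases "q \<le> Suc h")
        case True
        then show ?thesis using eq same by (simp add: E_le E0_def prod_encode_eq)
      next
        case False
        \<comment> \<open>Division by \<open>p\<close> recovers the label, because the offset of the
          mode is below \<open>p\<close>.\<close>
        then have "3 * m < p" "3 * m' < p" using m same bound(4) by (auto simp: E_gt)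
        then have "((q - Suc h) * p + 3 * m) div p = q - Suc h" "((q' - Suc h) * p + 3 * m') div p = q' - Suc h"
          by simp_all
        moreover have "(q - Suc h) * p + 3 * m = (q' - Suc h) * p + 3 * m'"
          using eq False same by (simp add: E_gt)
        ultimately have "q - Suc h = q' - Suc h" by metis
        then show ?thesis using eq False same by (simp add: E_gt)
      qed
    qed
    show "q' \<in> fst ` set R \<union> {h} \<and> Suc r \<in> set (ms q') \<and> set (ms q) \<subseteq> set (ms q')"
      if i: "(q, IInc r q') \<in> set R" for q r q'
    proof (cases "(q, IInc r q') \<in> set P")
      case True
      have "q < h" "q' \<le> h" "r < k" using True labels' target_P[OF True] k[OF True] by force+
      then show ?thesis unfolding labels_R by (auto simp: ms_le)
    next
      case False
      then obtain j where "j < p" "q = lab (Suc j)" "r = 0" "q' = lab j" using i by (auto simp: set_R)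
      then show ?thesis using h0 unfolding labels_R by (auto simp: lab_def ms_def k_def)
    qed
    show "q1 \<in> fst ` set R \<union> {h} \<and> set (ms q) \<subseteq> set (ms q1) \<and> q2 \<in> fst ` set R \<union> {h} \<and> set (ms q) \<subseteq> set (ms q2)"
      if "(q, IDec r q1 q2) \<in> set R" for q r q1 q2
    proof -
      have P: "(q, IDec r q1 q2) \<in> set P" using that by (auto simp: set_R)
      have "q < h" "q1 \<le> h" "q2 \<le> h" using P labels' target_P[OF P] by force+
      then show ?thesis unfolding labels_R by (auto simp: ms_le)
    qed
    show "set (delta (load_safa p D)) =
       (\<Union>(q, i)\<in>set R. set (instr_trans E (ms q) (q, i))) \<union> set (final_trans E h)"
    proof -
      have load: "instr_trans E (ms (lab (Suc j))) (lab (Suc j), IInc 0 (lab j)) = load_trans p j" for j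
      proof -
        have "ms (lab (Suc j)) = [1]" by (simp add: lab_def ms_def)
        then show ?thesis by (simp add: load_trans_def E_lab E_lab[simplified] insset_def)
      qed
      have P: "instr_trans E (ms q) (q, i) = instr_trans E0 [1..<Suc k] (q, i)" if "(q, i) \<in> set P" for q i
      proof -
        have "q < h" using that labels' by force
        then have "q \<le> Suc h" by simp
        then show ?thesis
          using target_P[OF that] by (cases i) (simp_all add: E_le ms_le)
      qed
      have F: "final_trans E h = final_trans E0 h" by (simp add: final_trans_def E_le)
      have "set D = (\<Union>(q, i)\<in>set P. set (instr_trans E (ms q) (q, i))) \<union> set (final_trans E h)"
      proof -
        have "(1, 0, always, None, 1) \<in> set (final_trans E0 h)" by (simp add: final_trans_def)
        moreover have "(\<Union>x\<in>set P. set (instr_trans E0 [1..<Suc k] x)) =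
            (\<Union>(q, i)\<in>set P. set (instr_trans E (ms q) (q, i)))"
          using P by (intro SUP_cong refl) (auto simp del: instr_trans.simps)
        ultimately show ?thesis unfolding D_def F by (auto simp: set_replicate_conv_if simp del: instr_trans.simps)
      qed
      then show ?thesis by (auto simp: load_safa_def set_R load simp del: instr_trans.simps)
    qed
  qed
  have run: "(mstep R)\<^sup>*\<^sup>* (lab n, s) (0, s(0 := s 0 + n))" if "n \<le> p" for n s
    using that
  proof (induction n arbitrary: s)
    case 0
    then show ?case by (simp add: lab_def)
  next
    case (Suc n)
    have "mstep R (lab (Suc n), s) (lab n, s(0 := Suc (s 0)))"
      using Suc.prems by (intro mstep_inc) (auto simp: R_def)
    moreover have "(mstep R)\<^sup>*\<^sup>* (lab n, s(0 := Suc (s 0))) (0, s(0 := s 0 + Suc n))"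
    proof -
      let ?s = "s(0 := Suc (s 0))"
      have "?s(0 := ?s 0 + n) = s(0 := s 0 + Suc n)" by auto
      with Suc.IH[of ?s] Suc.prems show ?thesis by (simp only: Suc_leD)
    qed
    ultimately show ?case by (rule converse_rtranclp_into_rtranclp)
  qed
  have "universal (load_safa p D) \<longleftrightarrow> t 1 \<noteq> 0" if t: "bigstep c ((\<lambda>_. 0)(0 := p)) t" for t
  proof -
    have "mhalts R (lab p) h \<longleftrightarrow> t 1 = 0"
    proof (rule mhalts_compile_guarded[OF _ distinct halt(1) _ t])
      show "set (compile (Seq c (While 1 (Inc 1))) 0 h) \<subseteq> set R" by (auto simp: R_def P_def g_def)
      show "(mstep R)\<^sup>*\<^sup>* (lab p, \<lambda>_. 0) (0, (\<lambda>_. 0)(0 := p))" using run[of p "\<lambda>_. 0"] by simp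
    qed
    then show ?thesis using universal_iff_not_halts[OF wf] by (simp add: load_safa_def)
  qed
  then show ?thesis using p_def wf by blast
qed

theorem theorem5:
  shows "\<not> decidable_on (encode_safa ` {M. wf_safa M})
           (\<lambda>n. \<exists>M. wf_safa M \<and> encode_safa M = n \<and> universal M)"
proof
  let ?U = "\<lambda>n. \<exists>M. wf_safa M \<and> encode_safa M = n \<and> universal M"
  assume "decidable_on (encode_safa ` {M. wf_safa M}) ?U"
  then obtain f where f: "\<And>M. wf_safa M \<Longrightarrow> eval f [encode_safa M] (if ?U (encode_safa M) then 1 else 0)"
    unfolding decidable_on_def by blast
  obtain l where l: "\<And>p. eval l [p] (load_code p)"
    using computable_unaryE[OF computable_load_code] by blast
  \<comment> \<open>The guard halts on zero, whereas the machine shall halt when \<open>f\<close>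
    answers 1; hence the negation.\<close>
  have "computable (Suc 0) (\<lambda>xs. if xs ! 0 = 0 then 1 else 0)"
    by (rule computable_prim[OF computable_const[of 0 1] computable_const[of 2 0, unfolded numeral_2_eq_2]])
      (metis neq0_conv nth_Cons_0 old.nat.simps(6,7) gr0_conv_Suc)
  then obtain neg where neg: "\<And>x. eval neg [x] (if x = 0 then 1 else 0)"
    using computable_unaryE[of "\<lambda>x. if x = 0 then 1 else 0"] by auto
  obtain c where c: "implements c (Comp neg [Comp f [l]]) [0] 1 2"
    using recf_implementable[of "[0]" 2 1] by auto
  obtain p D where pD: "p = list_encode (map encode_trans D)" "wf_safa (load_safa p D)"
    "\<And>t. bigstep c ((\<lambda>_. 0)(0 := p)) t \<Longrightarrow> universal (load_safa p D) \<longleftrightarrow> t 1 \<noteq> 0"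
    using program_safa_exists[of c] by blast
  let ?M = "load_safa p D"
  \<comment> \<open>The decider speaks about codes; injectivity carries its answer over to this
    automaton.\<close>
  have U: "?U (encode_safa ?M) \<longleftrightarrow> universal ?M" using inj_encode_safa pD(2) by blast
  have "eval f [load_code p] (if universal ?M then 1 else 0)"
    using f[OF pD(2)] by (simp only: U) (simp only: encode_load_safa[OF pD(1)])
  then have "eval (Comp f [l]) [p] (if universal ?M then 1 else 0)"
    using l by (intro eval_Comp[where ys = "[load_code p]"]) auto
  moreover have "eval neg [if universal ?M then 1 else 0] (if universal ?M then 0 else 1)"
    using neg[of "if universal ?M then 1 else 0"] by (simp split: if_splits)
  ultimately have "eval (Comp neg [Comp f [l]]) [p] (if universal ?M then 0 else 1)"
    by (intro eval_Comp[where ys = "[if universal ?M then 1 else 0]"]) auto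
  then have "bigstep c ((\<lambda>_. 0)(0 := p)) ((\<lambda>_. 0)(0 := p, 1 := if universal ?M then 0 else 1))"
    using c unfolding implements_def by auto
  \<comment> \<open>The program leaves 0 in register 1 iff the automaton is universal, while the
    automaton of this very run is universal iff register 1 is nonzero.\<close>
  from pD(3)[OF this] show False by (simp split: if_splits)
qed

end
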